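(* Let $n,k\in\mathbb N$ (positive integers), let $f\in C(T)$ and let $\alpha>1$ be real. Then $$E_n(f)\le\left(\cos\frac{\pi}{2\alpha}\right)^{-1}\gamma_{2k}^*\;\omega_{2k}\!\left(f,\frac{\alpha}{2n}\right).$$
   Context: All functions are real-valued; $T=\mathbb R/\mathbb Z$, so functions on $T$ are 1-periodic functions on $\mathbb R$, and $C(T)$ is the space of continuous functions on $T$. $T_{2n-1}$ is the space of 1-periodic real trigonometric polynomials of degree $\le n-1$, i.e. functions $\sum_{j=0}^{n-1}a_j\cos(2\pi jx)+\sum_{j=1}^{n-1}b_j\sin(2\pi jx)$ with real coefficients. $\|\cdot\|$ is the supremum norm, and $E_n(f):=\inf_{\tau\in T_{2n-1}}\|f-\tau\|$. For $r\in\mathbb N$, $\Delta_t^rf(x):=\sum_{j=0}^r(-1)^j\binom rj f(x+jt)$ and $\omega_r(f,h):=\sup_{0<t\le h}\|\Delta_t^rf\|$ is the $r$-th modulus of smoothness. $\gamma_{2k}^*:=\binom{2k}{k}^{-1}$. *)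

theory Defs
  imports "HOL-Analysis.Analysis"
begin

(* Functions on T = R/Z are represented as 1-periodic functions on the reals. *)
definition C_T :: "(real \<Rightarrow> real) set" where
  "C_T = {f. continuous_on UNIV f \<and> (\<forall>x. f (x + 1) = f x)}"

(* Meaningful for bounded functions only: on the reals, SUP of an unbounded family is
   unspecified.  Below it is applied to members of C_T, which are bounded. *)
definition sup_norm :: "(real \<Rightarrow> real) \<Rightarrow> real" where
  "sup_norm g = (SUP x. \<bar>g x\<bar>)"

(* The space T_{2n-1}: degree at most n - 1, hence dimension 2n - 1 for n \<ge> 1. *)
definition trig_polys :: "nat \<Rightarrow> (real \<Rightarrow> real) set" where
  "trig_polys n =
     {\<tau>. \<exists>a b :: nat \<Rightarrow> real. \<forall>x. \<tau> x =
        (\<Sum>j\<in>{0..<n}. a j * cos (2 * pi * real j * x)) +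
        (\<Sum>j\<in>{1..<n}. b j * sin (2 * pi * real j * x))}"

definition best_approx :: "nat \<Rightarrow> (real \<Rightarrow> real) \<Rightarrow> real" where
  "best_approx n f = (INF \<tau>\<in>trig_polys n. sup_norm (\<lambda>x. f x - \<tau> x))"

definition fin_diff :: "nat \<Rightarrow> real \<Rightarrow> (real \<Rightarrow> real) \<Rightarrow> real \<Rightarrow> real" where
  "fin_diff r t f x = (\<Sum>j=0..r. (- 1) ^ j * real (r choose j) * f (x + real j * t))"

(* Used with h > 0, so that the index set is nonempty. *)
definition modulus_smoothness :: "nat \<Rightarrow> (real \<Rightarrow> real) \<Rightarrow> real \<Rightarrow> real" where
  "modulus_smoothness r f h = (SUP t\<in>{0<..h}. sup_norm (fin_diff r t f))"

(* The constant \<gamma>*_{2k}, indexed by k. *)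
definition gamma_star_even :: "nat \<Rightarrow> real" where
  "gamma_star_even k = inverse (real ((2 * k) choose k))"

end

theory Submission
  imports Defs
begin

text \<open>
  Put \<open>h = \<alpha> / (2 n)\<close> and \<open>y = 1 / \<alpha>\<close>, and call an operator on trigonometric polynomials that multiplies the
  coefficients at frequency \<open>j\<close> by \<open>c j\<close> a multiplier.  The function \<open>f\<close> is averaged against its own
  differences:
  \<open>W f (x) = \<gamma> (2 / h\<^sup>2) \<integral>\<^sub>0\<^sup>h (h - t) (-1)\<^sup>k \<Delta>\<^sub>t\<^sup>2\<^sup>k f (x - k t) dt\<close> with \<open>\<gamma> = gamma_star_even k\<close>, which is at most
  \<open>\<gamma>\<close> times the modulus of smoothness, because the weight has total mass one.  The operator \<open>W\<close> is the multiplier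
  \<open>1 - u\<close>, where \<open>u j = S j (n / j)\<^sup>2\<close> and \<open>S\<close> is a finite combination of translations.  The total weight of
  these translations is at most \<open>y\<^sup>2\<close>: only the odd (or only the even) shifts survive in the estimate, and
  \<open>1 + 1/9 + 1/25 + \<dots> = \<pi>\<^sup>2 / 8\<close> (\<open>averaged_multiplier_eq\<close>, \<open>averaging_defect_bound\<close>).

  On the frequencies \<open>j \<ge> n\<close> the geometric series inverts \<open>W\<close>, so there \<open>f\<close> agrees with
  \<open>\<Sum>\<^sub>m S\<^sup>m (n / j)\<^sup>2\<^sup>m W f\<close>, and frequencies below \<open>n\<close> may be altered freely since they belong to the
  approximating space.  Using this freedom, the multiplier \<open>(n / j)\<^sup>2\<^sup>m\<close> can be continued below \<open>n\<close> with
  operator norm equal to the Favard constant.  To see this, write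
  \<open>(n / j)\<^sup>p\<^sup>+\<^sup>1 = \<integral>\<^sub>0\<^sup>\<infinity> (s\<^sup>p / p!) exp (- s j / n) ds\<close>.  The factor \<open>exp (- s j / n)\<close> is the Fourier coefficient, for
  \<open>j \<ge> n\<close>, of the kernel \<open>cos (2 \<pi> n t) P\<^sub>q(t) / cosh s\<close> with the Poisson kernel \<open>P\<^sub>q\<close>, \<open>q = exp (- s / n)\<close>.  As \<open>P\<^sub>q\<close>
  is positive, the \<open>L\<^sup>1\<close> norm of this kernel can be computed: it is \<open>(4 / \<pi>) arctan (exp (- s))\<close>
  (\<open>damping_multiplier_bound\<close>, \<open>inverse_power_multiplier_bound\<close>).

  It remains to sum the norms.  With the power series of \<open>sinh\<close> they give
  \<open>1 + \<integral>\<^sub>0\<^sup>\<infinity> y sinh (y s) (4 / \<pi>) arctan (exp (- s)) ds\<close>, which after integration by parts is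
  \<open>(2 / \<pi>) \<integral>\<^sub>0\<^sup>\<infinity> cosh (y s) / cosh s ds\<close>, a Beta integral whose value is \<open>1 / cos (\<pi> y / 2)\<close> by the reflection formula
  (\<open>sum_arctan_moments_le\<close>).  This proves the estimate for trigonometric polynomials up to an arbitrarily small
  error (\<open>trig_sum_jackson\<close>), and their density in the continuous periodic functions gives the theorem.
\<close>

section \<open>Multipliers on trigonometric sums\<close>

definition trig_sum :: "nat \<Rightarrow> (nat \<Rightarrow> real) \<Rightarrow> (nat \<Rightarrow> real) \<Rightarrow> real \<Rightarrow> real" where
  "trig_sum N a b x =
     (\<Sum>j<N. a j * cos (2 * pi * real j * x) + b j * sin (2 * pi * real j * x))"

text \<open>
  The operator norm, for the supremum norm, of the multiplier \<open>c\<close> on all trigonometric sums is at most \<open>C\<close>.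
  Sine and cosine coefficients receive the same factor, so such an operator commutes with translations.
\<close>

definition multiplier_bound :: "(nat \<Rightarrow> real) \<Rightarrow> real \<Rightarrow> bool" where
  "multiplier_bound c C \<longleftrightarrow>
     (\<forall>N a b G. (\<forall>x. \<bar>trig_sum N a b x\<bar> \<le> G) \<longrightarrow>
        (\<forall>x. \<bar>trig_sum N (\<lambda>j. c j * a j) (\<lambda>j. c j * b j) x\<bar> \<le> C * G))"

lemma multiplier_boundI:
  assumes "\<And>N a b G x. (\<And>z. \<bar>trig_sum N a b z\<bar> \<le> G) \<Longrightarrow>
      \<bar>trig_sum N (\<lambda>j. c j * a j) (\<lambda>j. c j * b j) x\<bar> \<le> C * G"
  shows "multiplier_bound c C"
  using assms unfolding multiplier_bound_def by blast

lemma multiplier_boundD: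
  assumes "multiplier_bound c C" "\<And>z. \<bar>trig_sum N a b z\<bar> \<le> G"
  shows "\<bar>trig_sum N (\<lambda>j. c j * a j) (\<lambda>j. c j * b j) x\<bar> \<le> C * G"
  using assms unfolding multiplier_bound_def by blast

lemma trig_sum_add:
  "trig_sum N a b x + trig_sum N a' b' x = trig_sum N (\<lambda>j. a j + a' j) (\<lambda>j. b j + b' j) x"
  unfolding trig_sum_def by (simp add: sum.distrib[symmetric] algebra_simps)

lemma trig_sum_scale:
  "c * trig_sum N a b x = trig_sum N (\<lambda>j. c * a j) (\<lambda>j. c * b j) x"
  unfolding trig_sum_def by (simp add: sum_distrib_left algebra_simps)

lemma abs_trig_sum_le: "\<bar>trig_sum N a b x\<bar> \<le> (\<Sum>j<N. \<bar>a j\<bar> + \<bar>b j\<bar>)"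
proof -
  have "\<bar>a j * cos y + b j * sin y\<bar> \<le> \<bar>a j\<bar> + \<bar>b j\<bar>" for j y
  proof -
    have "\<bar>a j * cos y\<bar> \<le> \<bar>a j\<bar>" "\<bar>b j * sin y\<bar> \<le> \<bar>b j\<bar>"
      by (simp_all add: abs_mult mult_left_le)
    then show ?thesis by linarith
  qed
  then show ?thesis
    unfolding trig_sum_def by (intro order_trans[OF sum_abs] sum_mono)
qed

lemma multiplier_bound_const: "multiplier_bound (\<lambda>_. c) \<bar>c\<bar>"
  by (rule multiplier_boundI)
    (simp add: trig_sum_scale[symmetric] abs_mult mult_left_mono)

lemma multiplier_bound_add:
  assumes "multiplier_bound c C" "multiplier_bound d D"
  shows "multiplier_bound (\<lambda>j. c j + d j) (C + D)"
proof (rule multiplier_boundI)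
  fix N a b G x assume *: "\<And>z. \<bar>trig_sum N a b z\<bar> \<le> G"
  show "\<bar>trig_sum N (\<lambda>j. (c j + d j) * a j) (\<lambda>j. (c j + d j) * b j) x\<bar> \<le> (C + D) * G"
    using multiplier_boundD[OF assms(1) *, of x] multiplier_boundD[OF assms(2) *, of x]
    by (simp add: distrib_right trig_sum_add[symmetric])
qed

lemma multiplier_bound_mult:
  assumes "multiplier_bound c C" "multiplier_bound d D"
  shows "multiplier_bound (\<lambda>j. c j * d j) (C * D)"
proof (rule multiplier_boundI)
  fix N a b G x assume *: "\<And>z. \<bar>trig_sum N a b z\<bar> \<le> G"
  show "\<bar>trig_sum N (\<lambda>j. (c j * d j) * a j) (\<lambda>j. (c j * d j) * b j) x\<bar> \<le> (C * D) * G"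
    using multiplier_boundD[OF assms(1) multiplier_boundD[OF assms(2) *], of x]
    by (simp add: mult.assoc)
qed

lemma multiplier_bound_scale:
  assumes "multiplier_bound c C"
  shows "multiplier_bound (\<lambda>j. r * c j) (\<bar>r\<bar> * C)"
  using multiplier_bound_mult[OF multiplier_bound_const assms] .

lemma multiplier_bound_power:
  assumes "multiplier_bound c C"
  shows "multiplier_bound (\<lambda>j. c j ^ m) (C ^ m)"
proof (induction m)
  case 0
  show ?case using multiplier_bound_const[of 1] by simp
next
  case (Suc m)
  then show ?case using multiplier_bound_mult[OF assms] by simp
qed

lemma multiplier_bound_sum:
  assumes "\<And>i. i \<in> I \<Longrightarrow> multiplier_bound (c i) (C i)"
  shows "multiplier_bound (\<lambda>j. \<Sum>i\<in>I. c i j) (\<Sum>i\<in>I. C i)"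
  using assms
proof (induction I rule: infinite_finite_induct)
  case (insert i I)
  then show ?case using multiplier_bound_add[of "c i" "C i"] by simp
qed (use multiplier_bound_const[of 0] in auto)

lemma multiplier_bound_mono:
  assumes "multiplier_bound c C" "C \<le> D"
  shows "multiplier_bound c D"
proof (rule multiplier_boundI)
  fix N a b G x assume *: "\<And>z. \<bar>trig_sum N a b z\<bar> \<le> G"
  have "0 \<le> G" using *[of 0] by linarith
  then have "C * G \<le> D * G" using assms(2) by (rule mult_right_mono[rotated])
  then show "\<bar>trig_sum N (\<lambda>j. c j * a j) (\<lambda>j. c j * b j) x\<bar> \<le> D * G"
    using multiplier_boundD[OF assms(1) *, of x] by linarith
qed

text \<open>
  Averaging over the shifts by \<open>t\<close> and \<open>- t\<close> cancels the terms that would mix sines with cosines, so that every kernel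
  acts as a multiplier, whether it is even or not.
\<close>

lemma trig_sum_symmetric_shift:
  "(trig_sum N a b (x + t) + trig_sum N a b (x - t)) / 2 =
   trig_sum N (\<lambda>j. cos (2 * pi * real j * t) * a j) (\<lambda>j. cos (2 * pi * real j * t) * b j) x"
proof -
  have "a j * cos (2 * pi * real j * (x + t)) + b j * sin (2 * pi * real j * (x + t)) +
      (a j * cos (2 * pi * real j * (x - t)) + b j * sin (2 * pi * real j * (x - t))) =
      2 * (cos (2 * pi * real j * t) * a j * cos (2 * pi * real j * x) +
        cos (2 * pi * real j * t) * b j * sin (2 * pi * real j * x))" for j
    by (simp add: distrib_left right_diff_distrib cos_add cos_diff sin_add sin_diff algebra_simps)
  then have "trig_sum N a b (x + t) + trig_sum N a b (x - t) = 2 *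
      trig_sum N (\<lambda>j. cos (2 * pi * real j * t) * a j) (\<lambda>j. cos (2 * pi * real j * t) * b j) x"
    unfolding trig_sum_def sum_distrib_left by (subst sum.distrib[symmetric]) simp
  then show ?thesis by simp
qed

lemma multiplier_bound_cos: "multiplier_bound (\<lambda>j. cos (2 * pi * real j * t)) 1"
proof (rule multiplier_boundI)
  fix N a b G x assume *: "\<And>z. \<bar>trig_sum N a b z\<bar> \<le> G"
  show "\<bar>trig_sum N (\<lambda>j. cos (2 * pi * real j * t) * a j)
      (\<lambda>j. cos (2 * pi * real j * t) * b j) x\<bar> \<le> 1 * G"
    using *[of "x + t"] *[of "x - t"]
    unfolding trig_sum_symmetric_shift[symmetric] by simp
qed

lemma has_integral_trig_sum:
  assumes "\<And>j. (\<lambda>s. \<phi> s j) integrable_on A"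
  shows "((\<lambda>s. trig_sum N (\<lambda>j. \<phi> s j * a j) (\<lambda>j. \<phi> s j * b j) x) has_integral
    trig_sum N (\<lambda>j. integral A (\<lambda>s. \<phi> s j) * a j) (\<lambda>j. integral A (\<lambda>s. \<phi> s j) * b j) x) A"
proof -
  have "((\<lambda>s. \<phi> s j) has_integral integral A (\<lambda>s. \<phi> s j)) A" for j
    using assms by blast
  then show ?thesis
    unfolding trig_sum_def
    by (intro has_integral_sum has_integral_add has_integral_mult_left) auto
qed

text \<open>
  This is Minkowski's integral inequality.  It is used twice: with \<open>s\<close> the variable of a convolution kernel, and with
  \<open>s\<close> the variable of a Laplace transform.
\<close>

lemma multiplier_bound_integral:
  assumes "\<And>s. s \<in> A \<Longrightarrow> multiplier_bound (\<phi> s) (C s)"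
    and "\<And>j. (\<lambda>s. \<phi> s j) integrable_on A" and "C integrable_on A"
  shows "multiplier_bound (\<lambda>j. integral A (\<lambda>s. \<phi> s j)) (integral A C)"
proof (rule multiplier_boundI)
  fix N a b G x assume *: "\<And>z. \<bar>trig_sum N a b z\<bar> \<le> G"
  let ?F = "\<lambda>s. trig_sum N (\<lambda>j. \<phi> s j * a j) (\<lambda>j. \<phi> s j * b j) x"
  have I: "(?F has_integral trig_sum N (\<lambda>j. integral A (\<lambda>s. \<phi> s j) * a j)
      (\<lambda>j. integral A (\<lambda>s. \<phi> s j) * b j) x) A"
    using assms(2) by (rule has_integral_trig_sum)
  have C: "((\<lambda>s. C s * G) has_integral integral A C * G) A"
    using assms(3) by (intro has_integral_mult_left) blast
  have "norm (integral A ?F) \<le> integral A (\<lambda>s. C s * G)"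
    using I C multiplier_boundD[OF assms(1) *]
    by (intro integral_norm_bound_integral) (auto simp: has_integral_iff)
  then show "\<bar>trig_sum N (\<lambda>j. integral A (\<lambda>s. \<phi> s j) * a j)
      (\<lambda>j. integral A (\<lambda>s. \<phi> s j) * b j) x\<bar> \<le> integral A C * G"
    using I C by (simp add: integral_unique)
qed

lemma multiplier_bound_kernel:
  fixes K :: "real \<Rightarrow> real"
  assumes "continuous_on {p..q} K"
  shows "multiplier_bound (\<lambda>j. integral {p..q} (\<lambda>t. K t * cos (2 * pi * real j * t)))
    (integral {p..q} (\<lambda>t. \<bar>K t\<bar>))"
proof (rule multiplier_bound_integral)
  show "multiplier_bound (\<lambda>j. K t * cos (2 * pi * real j * t)) \<bar>K t\<bar>" for t
    using multiplier_bound_scale[OF multiplier_bound_cos, of "K t" t] by simp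
qed (use assms in \<open>auto intro!: integrable_continuous_real continuous_intros\<close>)

section \<open>Density of trigonometric sums\<close>

lemma trig_sum_pad:
  assumes "N \<le> M"
  shows "trig_sum N a b x =
    trig_sum M (\<lambda>j. if j < N then a j else 0) (\<lambda>j. if j < N then b j else 0) x"
proof -
  have "{..<N} \<subseteq> {..<M}" using assms by auto
  then show ?thesis
    unfolding trig_sum_def by (intro sum.mono_neutral_cong_left) auto
qed

definition trig_functions :: "(real \<Rightarrow> real) set" where
  "trig_functions = {g. \<exists>N a b. g = trig_sum N a b}"

lemma trig_functions_add:
  assumes "g \<in> trig_functions" "h \<in> trig_functions"
  shows "(\<lambda>x. g x + h x) \<in> trig_functions"
proof -
  obtain N a b M a' b' where "g = trig_sum N a b" "h = trig_sum M a' b'"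
    using assms unfolding trig_functions_def by blast
  then have "(\<lambda>x. g x + h x) = (\<lambda>x. trig_sum (max N M)
      (\<lambda>j. (if j < N then a j else 0) + (if j < M then a' j else 0))
      (\<lambda>j. (if j < N then b j else 0) + (if j < M then b' j else 0)) x)"
    using trig_sum_pad[of N "max N M" a b] trig_sum_pad[of M "max N M" a' b']
    by (simp add: trig_sum_add)
  then show ?thesis unfolding trig_functions_def by blast
qed

lemma trig_functions_scale:
  assumes "g \<in> trig_functions"
  shows "(\<lambda>x. c * g x) \<in> trig_functions"
proof -
  obtain N a b where "g = trig_sum N a b" using assms unfolding trig_functions_def by blast
  then have "(\<lambda>x. c * g x) = trig_sum N (\<lambda>j. c * a j) (\<lambda>j. c * b j)"
    by (simp add: trig_sum_scale)
  then show ?thesis unfolding trig_functions_def by blast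
qed

lemma trig_functions_cos: "(\<lambda>x. cos (2 * pi * real j * x)) \<in> trig_functions"
proof -
  have "(\<lambda>x. cos (2 * pi * real j * x)) =
      trig_sum (Suc j) (\<lambda>i. if i = j then 1 else 0) (\<lambda>_. 0)"
    unfolding trig_sum_def by (auto simp: if_distrib[of "\<lambda>u. u * _"] cong: if_cong)
  then show ?thesis unfolding trig_functions_def by blast
qed

lemma trig_functions_sin: "(\<lambda>x. sin (2 * pi * real j * x)) \<in> trig_functions"
proof -
  have "(\<lambda>x. sin (2 * pi * real j * x)) =
      trig_sum (Suc j) (\<lambda>_. 0) (\<lambda>i. if i = j then 1 else 0)"
    unfolding trig_sum_def by (auto simp: if_distrib[of "\<lambda>u. u * _"] cong: if_cong)
  then show ?thesis unfolding trig_functions_def by blast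
qed

lemma trig_functions_const: "(\<lambda>_. c) \<in> trig_functions"
  using trig_functions_scale[OF trig_functions_cos[of 0], of c] by simp

lemma trig_functions_sum:
  assumes "\<And>i. i \<in> I \<Longrightarrow> g i \<in> trig_functions"
  shows "(\<lambda>x. \<Sum>i\<in>I. g i x) \<in> trig_functions"
  using assms
  by (induction I rule: infinite_finite_induct)
    (auto intro: trig_functions_const trig_functions_add)

lemma trig_functions_int_frequency:
  "(\<lambda>x. cos (2 * pi * of_int m * x)) \<in> trig_functions"
  "(\<lambda>x. sin (2 * pi * of_int m * x)) \<in> trig_functions"
proof -
  obtain j where j: "m = int j \<or> m = - int j" by (metis int_cases2)
  show "(\<lambda>x. cos (2 * pi * of_int m * x)) \<in> trig_functions"
    using j trig_functions_cos[of j] by auto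
  show "(\<lambda>x. sin (2 * pi * of_int m * x)) \<in> trig_functions"
    using j trig_functions_sin[of j] trig_functions_scale[OF trig_functions_sin[of j], of "-1"]
    by auto
qed

lemma trig_functions_mult:
  assumes "g \<in> trig_functions" "h \<in> trig_functions"
  shows "(\<lambda>x. g x * h x) \<in> trig_functions"
proof -
  let ?c = "\<lambda>j x. cos (2 * pi * real j * x)" and ?s = "\<lambda>j x. sin (2 * pi * real j * x)"
  have plus: "2 * pi * real i * x + 2 * pi * real j * x = 2 * pi * of_int (int i + int j) * x"
    and minus: "2 * pi * real i * x - 2 * pi * real j * x = 2 * pi * of_int (int i - int j) * x"
    for i j x by (simp_all add: algebra_simps)
  have eqs: "?c i x * ?c j x = (1/2) * cos (2 * pi * of_int (int i - int j) * x) +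
        (1/2) * cos (2 * pi * of_int (int i + int j) * x)"
    "?s i x * ?s j x = (1/2) * cos (2 * pi * of_int (int i - int j) * x) +
        (-1/2) * cos (2 * pi * of_int (int i + int j) * x)"
    "?s i x * ?c j x = (1/2) * sin (2 * pi * of_int (int i + int j) * x) +
        (1/2) * sin (2 * pi * of_int (int i - int j) * x)" for i j x
    unfolding plus[symmetric] minus[symmetric] cos_add cos_diff sin_add sin_diff
    by (simp_all add: field_simps)
  have prods: "(\<lambda>x. ?c i x * ?c j x) \<in> trig_functions" "(\<lambda>x. ?s i x * ?s j x) \<in> trig_functions"
    "(\<lambda>x. ?s i x * ?c j x) \<in> trig_functions" for i j
    unfolding eqs
    by (intro trig_functions_add trig_functions_scale trig_functions_int_frequency)+
  obtain N a b M a' b' where gh: "g = trig_sum N a b" "h = trig_sum M a' b'"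
    using assms unfolding trig_functions_def by blast
  have "(\<lambda>x. g x * h x) = (\<lambda>x. \<Sum>i<N. \<Sum>j<M.
      ((a i * a' j) * (?c i x * ?c j x) + (a i * b' j) * (?s j x * ?c i x)) +
      ((b i * a' j) * (?s i x * ?c j x) + (b i * b' j) * (?s i x * ?s j x)))"
    unfolding gh trig_sum_def sum_product by (simp add: algebra_simps)
  also have "\<dots> \<in> trig_functions"
    by (intro trig_functions_sum trig_functions_add trig_functions_scale prods)
  finally show ?thesis .
qed

lemma periodic_int:
  fixes f :: "real \<Rightarrow> real"
  assumes "\<And>x. f (x + 1) = f x"
  shows "f (x + of_int m) = f x"
proof -
  have nat: "f (x + real j) = f x" for x j
  proof (induction j)
    case (Suc j)
    then show ?case using assms[of "x + real j"] by (simp add: algebra_simps)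
  qed simp
  show ?thesis
    using nat[of x "nat m"] nat[of "x + of_int m" "nat (- m)"] by (cases "m \<ge> 0") auto
qed

text \<open>
  The Stone-Weierstrass theorem is applied on the unit circle of the complex plane, where the point \<open>cis (2 \<pi> x)\<close>
  represents \<open>x\<close> modulo 1.
\<close>

lemma trig_functions_dense:
  assumes f: "f \<in> C_T" and "0 < e"
  obtains N a b where "\<And>x. \<bar>f x - trig_sum N a b x\<bar> \<le> e"
proof -
  have cont: "continuous_on UNIV f" and per: "\<And>x. f (x + of_int m) = f x" for m
    using f periodic_int[of f] unfolding C_T_def by auto
  have isCont_f: "isCont f x" for x
    using cont by (simp add: continuous_on_eq_continuous_at)
  define S where "S = sphere (0::complex) 1"
  define g where "g z = f (Arg z / (2 * pi))" for z
  define R where "R = {\<phi>::complex \<Rightarrow> real. continuous_on S \<phi> \<and>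
      (\<exists>p\<in>trig_functions. \<forall>x. \<phi> (cis (2 * pi * x)) = p x)}"
  have lift: "g (cis (2 * pi * x)) = f x" for x
  proof -
    have "cis (Arg (cis (2 * pi * x))) = cis (2 * pi * x)"
      using cis_Arg[of "cis (2 * pi * x)"] by (simp add: sgn_eq)
    then have "sin (Arg (cis (2 * pi * x))) = sin (2 * pi * x) \<and>
        cos (Arg (cis (2 * pi * x))) = cos (2 * pi * x)"
      by (simp add: complex_eq_iff)
    then obtain m :: int where "Arg (cis (2 * pi * x)) = 2 * pi * x + 2 * pi * of_int m"
      using sin_cos_eq_iff by blast
    then have "Arg (cis (2 * pi * x)) / (2 * pi) = x + of_int m"
      by (simp add: field_simps)
    then show ?thesis unfolding g_def by (simp add: per)
  qed
  interpret function_ring_on R S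
  proof
    show "compact S" unfolding S_def by simp
    fix u v :: complex assume uv: "u \<in> S" "v \<in> S" "u \<noteq> v"
    have "Re \<in> R" "Im \<in> R"
      unfolding R_def using trig_functions_cos[of 1] trig_functions_sin[of 1]
      by (fastforce intro!: continuous_intros)+
    then show "\<exists>\<phi>\<in>R. \<phi> u \<noteq> \<phi> v" using uv(3) by (auto simp: complex_eq_iff)
  next
    fix \<phi> \<psi> assume "\<phi> \<in> R" "\<psi> \<in> R"
    then obtain p q where pq: "p \<in> trig_functions" "q \<in> trig_functions"
      "\<And>x. \<phi> (cis (2 * pi * x)) = p x" "\<And>x. \<psi> (cis (2 * pi * x)) = q x"
      "continuous_on S \<phi>" "continuous_on S \<psi>"
      unfolding R_def by blast
    have "\<forall>x. \<phi> (cis (2 * pi * x)) + \<psi> (cis (2 * pi * x)) = p x + q x"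
      "\<forall>x. \<phi> (cis (2 * pi * x)) * \<psi> (cis (2 * pi * x)) = p x * q x"
      using pq(3,4) by simp_all
    then show "(\<lambda>z. \<phi> z + \<psi> z) \<in> R" "(\<lambda>z. \<phi> z * \<psi> z) \<in> R"
      unfolding R_def mem_Collect_eq
      by (blast intro: continuous_on_add[OF pq(5,6)] continuous_on_mult[OF pq(5,6)]
          bexI[OF _ trig_functions_add[OF pq(1,2)]] bexI[OF _ trig_functions_mult[OF pq(1,2)]])+
  next
    fix c show "(\<lambda>_. c) \<in> R"
      unfolding R_def mem_Collect_eq
      by (intro conjI continuous_on_const bexI[where x = "\<lambda>_. c"] allI refl trig_functions_const)
  next
    fix \<phi> assume "\<phi> \<in> R"
    then show "continuous_on S \<phi>" unfolding R_def mem_Collect_eq by (rule conjunct1)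
  qed
  have "continuous (at z within S) g" if z: "z \<in> S" for z
  proof (cases "z \<in> \<real>\<^sub>\<le>\<^sub>0")
    case False
    then have "continuous (at z) g"
      unfolding g_def
      by (intro isCont_o2[OF _ isCont_f] isCont_divide continuous_at_Arg[OF False]
          continuous_const) simp
    then show ?thesis by (rule continuous_at_imp_continuous_within)
  next
    case True
    then have z': "- z \<notin> \<real>\<^sub>\<le>\<^sub>0" using z unfolding S_def
      by (auto simp: complex_nonpos_Reals_iff cmod_def)
    have *: "f (Arg (- w) / (2 * pi) + 1 / 2) = g w" if "w \<in> S" for w
    proof -
      have "- cis (Arg (- w)) = w"
        using that cis_Arg[of "- w"] by (cases "w = 0") (auto simp: S_def sgn_eq)
      moreover have "cis (2 * pi * (Arg (- w) / (2 * pi) + 1 / 2)) = - cis (Arg (- w))"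
        by (simp add: distrib_left complex_eq_iff)
      ultimately show ?thesis using lift[of "Arg (- w) / (2 * pi) + 1 / 2"] by simp
    qed
    \<comment> \<open>On the branch cut of \<open>Arg\<close> the circle is parametrised from the antipode instead.\<close>
    have "continuous (at z) (\<lambda>w. f (Arg (- w) / (2 * pi) + 1 / 2))"
      by (intro isCont_o2[OF _ isCont_f] isCont_add isCont_divide continuous_const
          isCont_o2[where f = uminus and g = Arg, OF _ continuous_at_Arg[OF z']] continuous_minus continuous_ident) simp
    then have "continuous (at z within S) (\<lambda>w. f (Arg (- w) / (2 * pi) + 1 / 2))"
      by (rule continuous_at_imp_continuous_within)
    then show ?thesis
      by (rule continuous_transform_within[where \<delta>=1]) (use z * in auto)
  qed
  then have "continuous_on S g" by (simp add: continuous_on_eq_continuous_within)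
  then obtain \<phi> where \<phi>: "\<phi> \<in> R" "\<And>z. z \<in> S \<Longrightarrow> \<bar>g z - \<phi> z\<bar> < e"
    using Stone_Weierstrass_basic[OF _ \<open>0 < e\<close>] by blast
  then obtain N a b where "\<And>x. \<phi> (cis (2 * pi * x)) = trig_sum N a b x"
    unfolding R_def trig_functions_def by auto
  then have "\<bar>f x - trig_sum N a b x\<bar> \<le> e" for x
    using \<phi>(2)[of "cis (2 * pi * x)"] by (simp add: lift S_def less_imp_le)
  then show ?thesis by (rule that)
qed

section \<open>The Poisson kernel\<close>

definition poisson :: "real \<Rightarrow> real \<Rightarrow> real" where
  "poisson q t = (1 - q\<^sup>2) / (1 - 2 * q * cos (2 * pi * t) + q\<^sup>2)"

lemma poisson_denominator_pos:
  fixes q :: real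
  assumes "0 < q" "q < 1"
  shows "0 < 1 - 2 * q * cos y + q\<^sup>2"
proof -
  have "q * cos y \<le> q * 1" by (intro mult_left_mono) (use assms in auto)
  moreover have "0 < (1 - q)\<^sup>2" using assms by simp
  ultimately show ?thesis by (simp add: power2_eq_square algebra_simps)
qed

lemma poisson_pos:
  assumes "0 < q" "q < 1"
  shows "0 < poisson q t"
  unfolding poisson_def using assms poisson_denominator_pos[OF assms, of "2 * pi * t"]
  by (intro divide_pos_pos) (auto simp: power_less_one_iff abs_square_less_1)

lemma continuous_on_poisson [continuous_intros]:
  fixes g :: "'a::t2_space \<Rightarrow> real"
  assumes "0 < q" "q < 1" "continuous_on A g"
  shows "continuous_on A (\<lambda>t. poisson q (g t))"
proof -
  have "1 - 2 * q * cos (2 * pi * g t) + q\<^sup>2 \<noteq> 0" for t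
    using poisson_denominator_pos[OF assms(1,2), of "2 * pi * g t"] by linarith
  then show ?thesis
    unfolding poisson_def by (intro continuous_intros assms(3) ballI)
qed

text \<open>
  Integrating the series \<open>1 + 2 \<Sum> q\<^sup>j cos (2 \<pi> j t)\<close> term by term gives this function.  Unlike the primitive that is built from
  \<open>tan (\<pi> t)\<close>, it is smooth on the whole line.
\<close>

definition poisson_primitive :: "real \<Rightarrow> real \<Rightarrow> real" where
  "poisson_primitive q t =
     t + arctan (q * sin (2 * pi * t) / (1 - q * cos (2 * pi * t))) / pi"

lemma has_derivative_poisson_primitive:
  assumes q: "0 < q" "q < 1"
  shows "(poisson_primitive q has_real_derivative poisson q t) (at t within A)"
proof -
  let ?c = "cos (2 * pi * t)" and ?s = "sin (2 * pi * t)"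
  have "q * ?c \<le> q * 1" by (intro mult_left_mono) (use q in auto)
  then have d: "1 - q * ?c > 0" using q by linarith
  have D: "1 - 2 * q * ?c + q\<^sup>2 > 0" using poisson_denominator_pos[OF q] .
  have sc: "?s\<^sup>2 = 1 - ?c\<^sup>2" by (simp add: sin_squared_eq)
  have "1 + (q * ?s / (1 - q * ?c))\<^sup>2 = ((1 - q * ?c)\<^sup>2 + q\<^sup>2 * ?s\<^sup>2) / (1 - q * ?c)\<^sup>2"
    using d by (simp add: power_divide power_mult_distrib add_divide_distrib)
  also have "(1 - q * ?c)\<^sup>2 + q\<^sup>2 * ?s\<^sup>2 = 1 - 2 * q * ?c + q\<^sup>2"
    unfolding sc by (simp add: power2_eq_square algebra_simps)
  finally have E: "1 + (q * ?s / (1 - q * ?c))\<^sup>2 = (1 - 2 * q * ?c + q\<^sup>2) / (1 - q * ?c)\<^sup>2" .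
  have N: "(q * (?c * (2 * pi))) * (1 - q * ?c) - q * ?s * (q * (?s * (2 * pi))) = 2 * pi * (q * ?c - q\<^sup>2)"
    using sc by algebra
  have "((\<lambda>t. q * sin (2 * pi * t)) has_real_derivative q * (?c * (2 * pi))) (at t within A)"
    by (auto intro!: derivative_eq_intros)
  moreover have "((\<lambda>t. 1 - q * cos (2 * pi * t)) has_real_derivative q * (?s * (2 * pi)))
      (at t within A)"
    by (auto intro!: derivative_eq_intros)
  ultimately have "((\<lambda>t. q * sin (2 * pi * t) / (1 - q * cos (2 * pi * t))) has_real_derivative
      ((q * (?c * (2 * pi))) * (1 - q * ?c) - q * ?s * (q * (?s * (2 * pi)))) /
        ((1 - q * ?c) * (1 - q * ?c))) (at t within A)"
    using d by (intro DERIV_divide) auto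
  from DERIV_add[OF DERIV_ident DERIV_cdivide[OF DERIV_chain2[OF DERIV_arctan this]]]
  have "(poisson_primitive q has_real_derivative
      1 + (((q * (?c * (2 * pi))) * (1 - q * ?c) - q * ?s * (q * (?s * (2 * pi)))) / (1 - q * ?c)\<^sup>2) /
        (1 + (q * ?s / (1 - q * ?c))\<^sup>2) / pi) (at t within A)"
    unfolding poisson_primitive_def [abs_def]
    by (simp add: power2_eq_square divide_inverse mult.commute mult.left_commute)
  also have "1 + (((q * (?c * (2 * pi))) * (1 - q * ?c) - q * ?s * (q * (?s * (2 * pi)))) / (1 - q * ?c)\<^sup>2) /
        (1 + (q * ?s / (1 - q * ?c))\<^sup>2) / pi = 1 + 2 * (q * ?c - q\<^sup>2) / (1 - 2 * q * ?c + q\<^sup>2)"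
    unfolding E N using d D by simp
  also have "\<dots> = poisson q t"
    unfolding poisson_def using D by (simp add: field_simps power2_eq_square)
  finally show ?thesis .
qed

lemma poisson_has_integral:
  assumes "0 < q" "q < 1" "u \<le> v"
  shows "(poisson q has_integral (poisson_primitive q v - poisson_primitive q u)) {u..v}"
  using assms has_derivative_poisson_primitive[of q]
  by (intro fundamental_theorem_of_calculus)
    (auto simp: has_real_derivative_iff_has_vector_derivative[symmetric])

lemma cos_multiple_has_integral:
  "((\<lambda>t. cos (2 * pi * real j * t)) has_integral (if j = 0 then 1 else 0)) {-1/4..3/4}"
proof (cases "j = 0")
  case True
  then show ?thesis using has_integral_const_real[of "1::real" "-1/4" "3/4"] by simp
next
  case False
  let ?F = "\<lambda>t. sin (2 * pi * real j * t) / (2 * pi * real j)"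
  have "((\<lambda>t. cos (2 * pi * real j * t)) has_integral (?F (3/4) - ?F (-1/4))) {-1/4..3/4}"
    using False
    by (intro fundamental_theorem_of_calculus)
      (auto intro!: derivative_eq_intros
        simp: has_real_derivative_iff_has_vector_derivative[symmetric])
  moreover have "2 * pi * real j * (3/4) = 2 * pi * real j * (-1/4) + 2 * pi * real j"
    by (simp add: algebra_simps)
  then have "sin (2 * pi * real j * (3/4)) = sin (2 * pi * real j * (-1/4))"
    using cos_int_2pin[of "int j"] sin_int_2pin[of "int j"] by (simp only: sin_add) simp
  ultimately show ?thesis using False by simp
qed

text \<open>
  Multiplying the kernel by its denominator yields the three-term recurrence \<open>(1 + q\<^sup>2) I\<^sub>j = q (I\<^sub>j\<^sub>+\<^sub>1 + I\<^sub>j\<^sub>-\<^sub>1)\<close> for the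
  coefficients, so that no infinite series is needed.  The period \<open>[-1/4, 3/4]\<close> is convenient because \<open>cos (2 \<pi> t)\<close>
  changes sign in its interior only at \<open>1/4\<close>.
\<close>

lemma poisson_cos_integral:
  assumes q: "0 < q" "q < 1"
  shows "integral {-1/4..3/4} (\<lambda>t. poisson q t * cos (2 * pi * real j * t)) = q ^ j"
proof -
  let ?I = "\<lambda>j. integral {-1/4..3/4} (\<lambda>t. poisson q t * cos (2 * pi * real j * t))"
  let ?J = "\<lambda>j. integral {-1/4..3/4} (\<lambda>t. poisson q t * cos (2 * pi * real j * t) * cos (2 * pi * t))"
  have int: "(\<lambda>t. poisson q t * cos (2 * pi * real j * t)) integrable_on {-1/4..3/4}"
    "(\<lambda>t. poisson q t * cos (2 * pi * real j * t) * cos (2 * pi * t)) integrable_on {-1/4..3/4}" for j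
    by (intro integrable_continuous_real continuous_intros q)+
  have I0: "?I 0 = 1"
  proof -
    have "2 * pi * (3/4) = 2 * pi - pi / 2" by simp
    then have "cos (2 * pi * (3/4)) = 0" "sin (2 * pi * (3/4)) = -1"
      by (simp_all only: cos_diff sin_diff) simp_all
    moreover have "cos (2 * pi * (-1/4)) = 0" "sin (2 * pi * (-1/4)) = -1"
      by simp_all
    ultimately have "poisson_primitive q (3/4) - poisson_primitive q (-1/4) = 1"
      unfolding poisson_primitive_def by simp
    then show ?thesis
      using poisson_has_integral[OF q, of "-1/4" "3/4"] by (simp add: integral_unique)
  qed
  have rec: "(1 + q\<^sup>2) * ?I j - 2 * q * ?J j = (1 - q\<^sup>2) * (if j = 0 then 1 else 0)" for j
  proof -
    have "((\<lambda>t. (1 + q\<^sup>2) * (poisson q t * cos (2 * pi * real j * t)) -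
        2 * q * (poisson q t * cos (2 * pi * real j * t) * cos (2 * pi * t)))
      has_integral (1 + q\<^sup>2) * ?I j - 2 * q * ?J j) {-1/4..3/4}"
      using int by (intro has_integral_diff has_integral_mult_right) (auto simp: has_integral_iff)
    moreover have "(1 + q\<^sup>2) * (poisson q t * cos (2 * pi * real j * t)) -
        2 * q * (poisson q t * cos (2 * pi * real j * t) * cos (2 * pi * t)) =
        (1 - q\<^sup>2) * cos (2 * pi * real j * t)" for t
    proof -
      have "poisson q t * (1 - 2 * q * cos (2 * pi * t) + q\<^sup>2) = 1 - q\<^sup>2"
        unfolding poisson_def using poisson_denominator_pos[OF q, of "2 * pi * t"] by simp
      then show ?thesis by algebra
    qed
    ultimately have "((\<lambda>t. (1 - q\<^sup>2) * cos (2 * pi * real j * t))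
      has_integral (1 + q\<^sup>2) * ?I j - 2 * q * ?J j) {-1/4..3/4}" by simp
    then show ?thesis
      using has_integral_mult_right[OF cos_multiple_has_integral[of j], of "1 - q\<^sup>2"]
      by (rule has_integral_unique)
  qed
  have J0: "?J 0 = ?I 1" by simp
  have J: "2 * ?J (Suc j) = ?I (Suc (Suc j)) + ?I j" for j
  proof -
    have eq: "2 * (poisson q t * cos (2 * pi * real (Suc j) * t) * cos (2 * pi * t)) =
        poisson q t * cos (2 * pi * real (Suc (Suc j)) * t) + poisson q t * cos (2 * pi * real j * t)" for t
    proof -
      have "2 * pi * real (Suc (Suc j)) * t = 2 * pi * real (Suc j) * t + 2 * pi * t"
        "2 * pi * real j * t = 2 * pi * real (Suc j) * t - 2 * pi * t" by (simp_all add: algebra_simps)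
      then show ?thesis by (simp only: cos_add cos_diff) (simp only: algebra_simps)
    qed
    have "2 * ?J (Suc j) = integral {-1/4..3/4}
        (\<lambda>t. 2 * (poisson q t * cos (2 * pi * real (Suc j) * t) * cos (2 * pi * t)))"
      by simp
    also have "\<dots> = ?I (Suc (Suc j)) + ?I j"
      unfolding eq by (rule integral_add[OF int(1) int(1)])
    finally show ?thesis .
  qed
  have "?I j = q ^ j \<and> ?I (Suc j) = q ^ Suc j"
  proof (induction j)
    case 0
    have "(1 + q\<^sup>2) * 1 - 2 * q * ?I 1 = 1 - q\<^sup>2" using rec[of 0] I0 J0 by simp
    moreover have "u = q" if "(1 + q\<^sup>2) * 1 - 2 * q * u = 1 - q\<^sup>2" for u
    proof -
      have "2 * q * (u - q) = 0" using that by algebra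
      then show ?thesis using q by simp
    qed
    ultimately have "?I 1 = q" by blast
    then show ?case using I0 by simp
  next
    case (Suc j)
    have "q * ?I (Suc (Suc j)) = (1 + q\<^sup>2) * ?I (Suc j) - q * ?I j"
      using rec[of "Suc j"] J[of j] by (simp add: algebra_simps)
    also have "\<dots> = q * q ^ Suc (Suc j)"
      unfolding Suc.IH[THEN conjunct1] Suc.IH[THEN conjunct2]
      by (simp add: power2_eq_square algebra_simps)
    finally show ?case using q Suc.IH by (metis less_irrefl mult_left_cancel)
  qed
  then show ?thesis by simp
qed

text \<open>
  On \<open>[-1/4, 1/4]\<close> the cosine is nonnegative, on the rest of the period it is nonpositive.  The integral is
  therefore twice the integral over the first part minus the first Fourier coefficient.
\<close>

lemma poisson_abs_cos_integral:
  assumes r: "0 < r" "r < 1"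
  shows "integral {-1/4..3/4} (\<lambda>t. poisson r t * \<bar>cos (2 * pi * t)\<bar>) =
    (2 / pi) * (r + 1 / r) * arctan r"
proof -
  let ?f = "\<lambda>t. poisson r t * cos (2 * pi * t)"
  have int: "?f integrable_on {u..v}" "(\<lambda>t. poisson r t * \<bar>cos (2 * pi * t)\<bar>) integrable_on {u..v}" for u v
    by (intro integrable_continuous_real continuous_intros r)+
  have A: "integral {-1/4..1/4} (poisson r) = 1 / 2 + (2 / pi) * arctan r"
  proof -
    have "poisson_primitive r (1/4) - poisson_primitive r (-1/4) = 1 / 2 + (2 / pi) * arctan r"
      unfolding poisson_primitive_def by (simp add: arctan_minus)
    then show ?thesis using poisson_has_integral[OF r, of "-1/4" "1/4"] by (simp add: integral_unique)
  qed
  have "?f t = ((1 + r\<^sup>2) * poisson r t - (1 - r\<^sup>2)) / (2 * r)" for t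
  proof -
    have "poisson r t * (1 - 2 * r * cos (2 * pi * t) + r\<^sup>2) = 1 - r\<^sup>2"
      unfolding poisson_def using poisson_denominator_pos[OF r, of "2 * pi * t"] by simp
    then show ?thesis using r by (simp add: field_simps)
  qed
  moreover have "((\<lambda>t. ((1 + r\<^sup>2) * poisson r t - (1 - r\<^sup>2)) / (2 * r)) has_integral
      ((1 + r\<^sup>2) * (1 / 2 + (2 / pi) * arctan r) - (1 / 2) * (1 - r\<^sup>2)) / (2 * r)) {-1/4..1/4}"
  proof (intro has_integral_divide has_integral_diff has_integral_mult_right)
    show "(poisson r has_integral (1 / 2 + (2 / pi) * arctan r)) {-1/4..1/4}"
      using poisson_has_integral[OF r, of "-1/4" "1/4"] A by (simp add: has_integral_iff)
    show "((\<lambda>t. 1 - r\<^sup>2) has_integral (1 / 2) * (1 - r\<^sup>2)) {-1/4..1/4::real}"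
      using has_integral_const_real[of "1 - r\<^sup>2" "-1/4" "1/4"] by simp
  qed
  ultimately have half: "integral {-1/4..1/4} ?f =
      ((1 + r\<^sup>2) * (1 / 2 + (2 / pi) * arctan r) - (1 / 2) * (1 - r\<^sup>2)) / (2 * r)"
    by (simp only: integral_unique)
  have full: "integral {-1/4..1/4} ?f + integral {1/4..3/4} ?f = r"
    using Henstock_Kurzweil_Integration.integral_combine[of "-1/4" "1/4" "3/4" ?f] int(1)
      poisson_cos_integral[OF r, of 1] by simp
  have "integral {-1/4..1/4} (\<lambda>t. poisson r t * \<bar>cos (2 * pi * t)\<bar>) = integral {-1/4..1/4} ?f"
  proof (rule integral_cong)
    fix t :: real assume "t \<in> {-1/4..1/4}"
    then have "-1/2 \<le> 2 * t" "2 * t \<le> 1/2" by auto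
    then have "pi * (-1/2) \<le> pi * (2 * t)" "pi * (2 * t) \<le> pi * (1/2)"
      by (intro mult_left_mono; simp)+
    then have "0 \<le> cos (2 * pi * t)" by (intro cos_ge_zero) simp_all
    then show "poisson r t * \<bar>cos (2 * pi * t)\<bar> = ?f t" by simp
  qed
  moreover have "integral {1/4..3/4} (\<lambda>t. poisson r t * \<bar>cos (2 * pi * t)\<bar>) = integral {1/4..3/4} (\<lambda>t. - ?f t)"
  proof (rule integral_cong)
    fix t :: real assume "t \<in> {1/4..3/4}"
    then have "1/2 \<le> 2 * t" "2 * t \<le> 3/2" by auto
    then have "pi * (1/2) \<le> pi * (2 * t)" "pi * (2 * t) \<le> pi * (3/2)"
      by (intro mult_left_mono; simp)+
    then have "0 \<le> cos (2 * pi * t - pi)" by (intro cos_ge_zero; linarith)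
    then have "cos (2 * pi * t) \<le> 0" by (simp add: cos_diff)
    then show "poisson r t * \<bar>cos (2 * pi * t)\<bar> = - ?f t" by simp
  qed
  ultimately have "integral {-1/4..3/4} (\<lambda>t. poisson r t * \<bar>cos (2 * pi * t)\<bar>) =
      integral {-1/4..1/4} ?f - integral {1/4..3/4} ?f"
    using Henstock_Kurzweil_Integration.integral_combine[of "-1/4" "1/4" "3/4"
        "\<lambda>t. poisson r t * \<bar>cos (2 * pi * t)\<bar>"] int(2) by simp
  also have "\<dots> = 2 * integral {-1/4..1/4} ?f - r" using full by simp
  also have "\<dots> = (2 / pi) * (r + 1 / r) * arctan r"
    unfolding half using r by (simp add: field_simps power2_eq_square)
  finally show ?thesis .
qed

lemma poisson_even_sum_has_integral:
  assumes q: "0 < q" "q < 1"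
  shows "((\<lambda>t. poisson q t * (\<Sum>j<N. a j * cos (2 * pi * real j * (real m * t)))) has_integral
    (\<Sum>j<N. a j * q ^ (m * j))) {-1/4..3/4}"
proof -
  have "((\<lambda>t. poisson q t * cos (2 * pi * real (m * j) * t)) has_integral q ^ (m * j)) {-1/4..3/4}" for j
    unfolding poisson_cos_integral[OF q, symmetric]
    by (intro integrable_integral integrable_continuous_real continuous_intros q)
  then have "((\<lambda>t. \<Sum>j<N. a j * (poisson q t * cos (2 * pi * real (m * j) * t))) has_integral
      (\<Sum>j<N. a j * q ^ (m * j))) {-1/4..3/4}"
    by (intro has_integral_sum has_integral_mult_right) auto
  moreover have "(\<Sum>j<N. a j * (poisson q t * cos (2 * pi * real (m * j) * t))) =
      poisson q t * (\<Sum>j<N. a j * cos (2 * pi * real j * (real m * t)))" for t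
    unfolding sum_distrib_left by (intro sum.cong refl) (simp add: algebra_simps)
  ultimately show ?thesis by simp
qed

text \<open>
  Both sides have the same value \<open>\<Sum> a\<^sub>j q\<^sup>n\<^sup>j\<close> when the absolute value of the cosine is replaced by an even trigonometric
  sum with coefficients \<open>a\<^sub>j\<close>.  Density and the positivity of the kernel carry this over to the absolute value.
\<close>

lemma poisson_abs_cos_dilate:
  assumes q: "0 < q" "q < 1" and n: "n \<ge> 1"
  shows "integral {-1/4..3/4} (\<lambda>t. poisson q t * \<bar>cos (2 * pi * real n * t)\<bar>) =
    integral {-1/4..3/4} (\<lambda>t. poisson (q ^ n) t * \<bar>cos (2 * pi * t)\<bar>)"
    (is "?L = ?R")
proof -
  have qn: "0 < q ^ n" "q ^ n < 1" using q n by (auto simp: power_less_one_iff)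
  have close: "\<bar>?L - ?R\<bar> \<le> 2 * e" if "e > 0" for e
  proof -
    have "(\<lambda>x::real. \<bar>cos (2 * pi * x)\<bar>) \<in> C_T"
      unfolding C_T_def by (auto intro!: continuous_intros simp: distrib_left)
    then obtain N a b where ab: "\<And>x. \<bar>\<bar>cos (2 * pi * x)\<bar> - trig_sum N a b x\<bar> \<le> e"
      using trig_functions_dense \<open>e > 0\<close> by blast
    define E where "E x = (\<Sum>j<N. a j * cos (2 * pi * real j * x))" for x
    have even_part: "trig_sum N a b x + trig_sum N a b (- x) = 2 * E x" for x
      unfolding trig_sum_def E_def sum_distrib_left by (subst sum.distrib[symmetric]) simp
    have E: "\<bar>\<bar>cos (2 * pi * x)\<bar> - E x\<bar> \<le> e" for x
      using ab[of x] ab[of "- x"] even_part[of x] by (simp add: abs_le_iff)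
    have contE: "continuous_on A E" for A unfolding E_def by (intro continuous_intros)
    have dist: "\<bar>integral {-1/4..3/4} (\<lambda>t. poisson p t * \<bar>cos (2 * pi * (real m * t))\<bar>) -
        (\<Sum>j<N. a j * p ^ (m * j))\<bar> \<le> e" if p: "0 < p" "p < 1" for p m
    proof -
      have "((\<lambda>t. poisson p t * \<bar>cos (2 * pi * (real m * t))\<bar> - poisson p t * E (real m * t)) has_integral
          integral {-1/4..3/4} (\<lambda>t. poisson p t * \<bar>cos (2 * pi * (real m * t))\<bar>) -
          (\<Sum>j<N. a j * p ^ (m * j))) {-1/4..3/4}"
        unfolding E_def
        by (intro has_integral_diff poisson_even_sum_has_integral p integrable_integral
            integrable_continuous_real continuous_intros)
      moreover have "((\<lambda>t. poisson p t * e) has_integral 1 * e) {-1/4..3/4}"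
        using poisson_cos_integral[OF p, of 0] integrable_continuous_real[OF continuous_on_poisson[OF p continuous_on_id]]
        by (intro has_integral_mult_left) (simp add: has_integral_iff)
      moreover have "norm (poisson p t * \<bar>cos (2 * pi * (real m * t))\<bar> - poisson p t * E (real m * t))
          \<le> poisson p t * e" for t
        using poisson_pos[OF p, of t] E[of "real m * t"]
        by (simp add: right_diff_distrib[symmetric] abs_mult)
      ultimately show ?thesis
        using has_integral_integrable integral_norm_bound_integral
        by (metis (mono_tags, lifting) integral_unique mult_1 real_norm_def)
    qed
    show ?thesis
      using dist[OF q, of n] dist[OF qn, of 1] by (simp add: power_mult mult.assoc)
  qed
  then have "\<bar>?L - ?R\<bar> \<le> 0 + e" if "e > 0" for e using close[of "e / 2"] that by simp
  then have "\<bar>?L - ?R\<bar> \<le> 0" by (rule field_le_epsilon)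
  then show ?thesis by simp
qed

section \<open>Exponential damping of high frequencies\<close>

text \<open>
  The Fourier coefficients of \<open>cos (2 \<pi> n t) P\<^sub>q(t) / cosh s\<close> with \<open>q = exp (- s / n)\<close>.  The cosine moves the peak of the
  coefficients of \<open>P\<^sub>q\<close> from \<open>0\<close> to \<open>n\<close> and \<open>- n\<close>, and gives the kernel the sign pattern of an extremal signature for
  approximation by polynomials of degree less than \<open>n\<close>.
\<close>

definition damping :: "nat \<Rightarrow> real \<Rightarrow> nat \<Rightarrow> real" where
  "damping n s j =
     (exp (- (s * \<bar>real j - real n\<bar> / real n)) + exp (- (s * (real j + real n) / real n))) / (2 * cosh s)"

lemma damping_high:
  assumes "n \<ge> 1" "j \<ge> n"
  shows "damping n s j = exp (- (s * (real j / real n)))"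
proof -
  have "s * \<bar>real j - real n\<bar> / real n = s * (real j / real n) - s"
    "s * (real j + real n) / real n = s * (real j / real n) + s"
    using assms by (simp_all add: field_simps)
  then have "exp (- (s * \<bar>real j - real n\<bar> / real n)) + exp (- (s * (real j + real n) / real n)) =
     exp (- (s * (real j / real n))) * (exp s + exp (- s))"
    by (simp add: distrib_left exp_add[symmetric])
  also have "exp s + exp (- s) = 2 * cosh s" by (simp add: cosh_def)
  finally show ?thesis unfolding damping_def by simp
qed

lemma damping_multiplier_bound:
  assumes s: "s > 0" and n: "n \<ge> 1"
  shows "multiplier_bound (damping n s) (4 / pi * arctan (exp (- s)))"
proof -
  define q where "q = exp (- (s / real n))"
  have q: "0 < q" "q < 1" using s n by (auto simp: q_def)
  have pow: "q ^ i = exp (- (s * real i / real n))" for i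
    unfolding q_def by (simp add: exp_of_nat_mult[symmetric] algebra_simps)
  have qn: "q ^ n = exp (- s)" using n by (simp add: pow)
  define K where "K t = poisson q t * cos (2 * pi * real n * t) / cosh s" for t
  have contK: "continuous_on A K" for A
    unfolding K_def by (intro continuous_intros q) simp
  have coeff: "integral {-1/4..3/4} (\<lambda>t. K t * cos (2 * pi * real j * t)) = damping n s j" for j
  proof -
    define d where "d = nat \<bar>int j - int n\<bar>"
    have d: "real d = \<bar>real j - real n\<bar>" unfolding d_def by simp
    have int: "((\<lambda>t. poisson q t * cos (2 * pi * real i * t)) has_integral q ^ i) {-1/4..3/4}" for i
      unfolding poisson_cos_integral[OF q, symmetric]
      by (intro integrable_integral integrable_continuous_real continuous_intros q)
    have "K t * cos (2 * pi * real j * t) =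
        (poisson q t * cos (2 * pi * real d * t) + poisson q t * cos (2 * pi * real (j + n) * t)) / (2 * cosh s)" for t
    proof -
      have "cos (2 * pi * real d * t) = cos (2 * pi * real j * t - 2 * pi * real n * t)"
      proof (cases "j \<ge> n")
        case True
        then show ?thesis unfolding d by (simp add: algebra_simps)
      next
        case False
        then have "2 * pi * real d * t = - (2 * pi * real j * t - 2 * pi * real n * t)"
          unfolding d by (simp add: algebra_simps)
        then show ?thesis by (simp only: cos_minus)
      qed
      moreover have "2 * pi * real (j + n) * t = 2 * pi * real j * t + 2 * pi * real n * t"
        by (simp add: algebra_simps)
      ultimately show ?thesis unfolding K_def
        by (simp only: cos_add cos_diff) (simp add: field_simps)
    qed
    moreover have "((\<lambda>t. (poisson q t * cos (2 * pi * real d * t) +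
        poisson q t * cos (2 * pi * real (j + n) * t)) / (2 * cosh s)) has_integral
        (q ^ d + q ^ (j + n)) / (2 * cosh s)) {-1/4..3/4}"
      by (intro has_integral_divide has_integral_add int)
    moreover have "(q ^ d + q ^ (j + n)) / (2 * cosh s) = damping n s j"
      unfolding pow d damping_def by simp
    ultimately show ?thesis by (simp only: integral_unique)
  qed
  have "integral {-1/4..3/4} (\<lambda>t. \<bar>K t\<bar>) =
      integral {-1/4..3/4} (\<lambda>t. poisson q t * \<bar>cos (2 * pi * real n * t)\<bar> * (1 / cosh s))"
    using poisson_pos[OF q] by (intro integral_cong) (simp add: K_def abs_mult less_imp_le)
  also have "\<dots> = (2 / pi) * (exp (- s) + 1 / exp (- s)) * arctan (exp (- s)) * (1 / cosh s)"
    using poisson_abs_cos_dilate[OF q n] poisson_abs_cos_integral[of "exp (- s)"] s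
    by (simp only: integral_mult_left qn) simp
  also have "exp (- s) + 1 / exp (- s) = 2 * cosh s"
    by (simp add: cosh_def exp_minus field_simps)
  also have "(2 / pi) * (2 * cosh s) * arctan (exp (- s)) * (1 / cosh s) = 4 / pi * arctan (exp (- s))"
    by simp
  finally have "integral {-1/4..3/4} (\<lambda>t. \<bar>K t\<bar>) = 4 / pi * arctan (exp (- s))" .
  then show ?thesis
    using multiplier_bound_kernel[OF contK[of "{-1/4..3/4}"]] unfolding coeff by simp
qed

section \<open>Inverse powers of the frequency\<close>

lemma tendsto_integral_half_line:
  fixes h :: "real \<Rightarrow> real"
  assumes "h integrable_on {0..}"
  shows "((\<lambda>R. integral {0..R} h) \<longlongrightarrow> integral {0..} h) at_top"
proof (rule tendstoI)
  fix e :: real assume "e > 0"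
  let ?g = "\<lambda>x. if x \<in> {0..} then h x else 0"
  have "(h has_integral integral {0..} h) {0..}" using assms by (rule integrable_integral)
  then obtain B where B: "\<And>a b. ball 0 B \<subseteq> cbox a b \<Longrightarrow>
      norm (integral (cbox a b) ?g - integral {0..} h) < e" and "B > 0"
    using \<open>e > 0\<close> unfolding has_integral_alt' by blast
  show "\<forall>\<^sub>F R in at_top. dist (integral {0..R} h) (integral {0..} h) < e"
    using eventually_ge_at_top[of B]
  proof eventually_elim
    case (elim R)
    have "ball (0::real) B \<subseteq> cbox (- R) R" using elim by (auto simp: dist_real_def)
    moreover have "integral (cbox (- R) R) ?g = integral {0..R} h"
    proof -
      have "{0..} \<inter> cbox (- R) R = {0..R}" using elim \<open>B > 0\<close> by auto
      then show ?thesis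
        using integral_restrict_Int[of "cbox (- R) R" "{0..}" h] by (simp only: Int_commute)
    qed
    ultimately show ?case using B[of "- R" R] by (simp add: dist_real_def)
  qed
qed

text \<open>
  A primitive that vanishes at infinity is constructed by induction on \<open>p\<close>, following integration by parts.
\<close>

lemma power_exp_has_integral:
  fixes c :: real
  assumes c: "c > 0"
  shows "((\<lambda>s. s ^ p / fact p * exp (- (c * s))) has_integral 1 / c ^ Suc p) {0..}"
proof -
  have "\<exists>F. (\<forall>s. (F has_real_derivative s ^ p / fact p * exp (- (c * s))) (at s)) \<and>
      (F \<longlongrightarrow> 0) at_top \<and> F 0 = - (1 / c ^ Suc p)"
  proof (induction p)
    case 0
    show ?case
    proof (intro exI conjI allI)
      show "((\<lambda>s. - exp (- (c * s)) / c) has_real_derivative s ^ 0 / fact 0 * exp (- (c * s))) (at s)" for s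
        using c by (auto intro!: derivative_eq_intros)
      show "((\<lambda>s. - exp (- (c * s)) / c) \<longlongrightarrow> 0) at_top" using c by real_asymp
    qed simp
  next
    case (Suc p)
    then obtain F where F: "\<And>s. (F has_real_derivative s ^ p / fact p * exp (- (c * s))) (at s)"
      "(F \<longlongrightarrow> 0) at_top" "F 0 = - (1 / c ^ Suc p)" by blast
    let ?F = "\<lambda>s. (F s - s ^ Suc p / fact (Suc p) * exp (- (c * s))) / c"
    have "((\<lambda>s. s ^ Suc p / fact (Suc p)) has_real_derivative s ^ p / fact p) (at s)" for s :: real
    proof -
      have "((\<lambda>s. s ^ Suc p / fact (Suc p)) has_real_derivative
          (1 + real p) * (1 * s ^ p) / fact (Suc p)) (at s)"
        by (rule DERIV_cdivide[OF DERIV_power_Suc[OF DERIV_ident]])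
      moreover have "(1 + real p) * (1 * s ^ p) / fact (Suc p) = s ^ p / fact p"
        unfolding fact_Suc by simp
      ultimately show ?thesis by (simp only:)
    qed
    moreover have "((\<lambda>s. exp (- (c * s))) has_real_derivative exp (- (c * s)) * (- c)) (at s)" for s
      by (auto intro!: derivative_eq_intros)
    ultimately have "((\<lambda>s. s ^ Suc p / fact (Suc p) * exp (- (c * s))) has_real_derivative
        s ^ p / fact p * exp (- (c * s)) + exp (- (c * s)) * (- c) * (s ^ Suc p / fact (Suc p))) (at s)" for s
      by (rule DERIV_mult)
    note D = this
    have "(?F has_real_derivative s ^ Suc p / fact (Suc p) * exp (- (c * s))) (at s)" for s
      using DERIV_cdivide[OF DERIV_diff[OF F(1)[of s] D[of s]], of c] c by (simp add: mult_ac)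
    moreover have "(?F \<longlongrightarrow> 0) at_top"
    proof -
      have "((\<lambda>s. s ^ Suc p / fact (Suc p) * exp (- (c * s))) \<longlongrightarrow> 0) at_top"
        using c by real_asymp
      from tendsto_divide[OF tendsto_diff[OF F(2) this] tendsto_const, of c] c
      show ?thesis by simp
    qed
    moreover have "?F 0 = - (1 / c ^ Suc (Suc p))" using c by (simp add: F(3))
    ultimately show ?case by blast
  qed
  then obtain F where F: "\<And>s. (F has_real_derivative s ^ p / fact p * exp (- (c * s))) (at s)"
    "(F \<longlongrightarrow> 0) at_top" "F 0 = - (1 / c ^ Suc p)" by blast
  show ?thesis
  proof (rule has_integral_to_inf)
    show "(\<lambda>s. s ^ p / fact p * exp (- (c * s))) integrable_on {0..y}" for y
      by (intro integrable_continuous_real continuous_intros) auto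
    have "integral {0..y} (\<lambda>s. s ^ p / fact p * exp (- (c * s))) = F y - F 0" if "y \<ge> 0" for y
      using that F(1)
      by (intro integral_unique fundamental_theorem_of_calculus)
        (auto simp: has_real_derivative_iff_has_vector_derivative[symmetric]
          intro: has_field_derivative_at_within)
    then have "\<forall>\<^sub>F y in at_top. F y - F 0 = integral {0..y} (\<lambda>s. s ^ p / fact p * exp (- (c * s)))"
      by (intro eventually_mono[OF eventually_ge_at_top[of 0]]) simp
    moreover have "((\<lambda>y. F y - F 0) \<longlongrightarrow> 1 / c ^ Suc p) at_top"
      using tendsto_diff[OF F(2) tendsto_const, of "F 0"] by (simp add: F(3))
    ultimately show "((\<lambda>y. integral {0..y} (\<lambda>s. s ^ p / fact p * exp (- (c * s)))) \<longlongrightarrow> 1 / c ^ Suc p) at_top"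
      by (rule Lim_transform_eventually[rotated])
  qed auto
qed

text \<open>
  For \<open>j \<ge> n\<close> this is the Laplace representation of \<open>(n / j) ^ Suc p\<close>; its values for \<open>j < n\<close> are those of an
  extension with small operator norm.
\<close>

definition inverse_power_multiplier :: "nat \<Rightarrow> nat \<Rightarrow> nat \<Rightarrow> real" where
  "inverse_power_multiplier n p j = integral {0..} (\<lambda>s. s ^ p / fact p * damping n s j)"

text \<open>
  For odd \<open>p\<close> this is the Favard constant of order \<open>p + 1\<close>.
\<close>

definition arctan_moment :: "nat \<Rightarrow> real" where
  "arctan_moment p = integral {0..} (\<lambda>s. s ^ p / fact p * (4 / pi * arctan (exp (- s))))"

lemma integrable_on_half_line_exp_bound:
  fixes g :: "real \<Rightarrow> real"
  assumes "continuous_on {0..} g" and "\<And>s. s \<ge> 0 \<Longrightarrow> \<bar>g s\<bar> \<le> 2 * exp (- s)"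
  shows "(\<lambda>s. s ^ p / fact p * g s) integrable_on {0..}"
proof (rule measurable_bounded_by_integrable_imp_integrable_real)
  have "continuous_on {0..} (\<lambda>s. s ^ p / fact p * g s)"
    by (intro continuous_intros assms) auto
  then show "(\<lambda>s. s ^ p / fact p * g s) \<in> borel_measurable (lebesgue_on {0..})"
    by (rule continuous_imp_measurable_on_sets_lebesgue) auto
  show "(\<lambda>s. s ^ p / fact p * exp (- (1 * s)) * 2) integrable_on {0::real..}"
    by (rule has_integral_integrable[OF has_integral_mult_left[OF power_exp_has_integral]]) simp
  show "\<bar>s ^ p / fact p * g s\<bar> \<le> s ^ p / fact p * exp (- (1 * s)) * 2" if "s \<in> {0..}" for s
    using that mult_left_mono[OF assms(2)[of s], of "s ^ p / fact p"] by (simp add: abs_mult mult_ac)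
qed auto

lemma damping_le:
  assumes "s \<ge> 0"
  shows "\<bar>damping n s j\<bar> \<le> 2 * exp (- s)"
proof -
  let ?A = "exp (- (s * \<bar>real j - real n\<bar> / real n))"
    and ?B = "exp (- (s * (real j + real n) / real n))"
  have "?A \<le> 1" "?B \<le> 1" using assms by auto
  then have "?A + ?B \<le> 2" by linarith
  then have "\<bar>?A + ?B\<bar> \<le> 2" by (simp only: abs_of_pos[OF add_pos_pos[OF exp_gt_zero exp_gt_zero]])
  moreover have "1 / (2 * cosh s) \<le> exp (- s)"
    by (simp add: cosh_def exp_minus field_simps add_pos_pos)
  moreover have "\<bar>damping n s j\<bar> = \<bar>?A + ?B\<bar> * (1 / (2 * cosh s))"
    unfolding damping_def by (simp add: abs_divide)
  ultimately show ?thesis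
    by (simp only:) (intro mult_mono, auto)
qed

lemma arctan_exp_le: "\<bar>4 / pi * arctan (exp (- s))\<bar> \<le> 2 * exp (- s)"
proof -
  have "arctan (exp (- s)) \<le> exp (- s)" by (rule arctan_le_self) simp
  moreover have "4 / pi \<le> 2" using pi_ge_two by (simp add: field_simps)
  ultimately have "4 / pi * arctan (exp (- s)) \<le> 2 * exp (- s)" by (intro mult_mono) auto
  then show ?thesis by (simp add: abs_of_pos)
qed

lemma continuous_on_damping: "continuous_on A (\<lambda>s. damping n s j)"
  unfolding damping_def divide_inverse by (intro continuous_intros) auto

lemma inverse_power_multiplier_bound:
  assumes "n \<ge> 1" "p \<ge> 1"
  shows "multiplier_bound (inverse_power_multiplier n p) (arctan_moment p)"
  unfolding inverse_power_multiplier_def[abs_def] arctan_moment_def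
proof (rule multiplier_bound_integral)
  fix s :: real assume s: "s \<in> {0..}"
  show "multiplier_bound (\<lambda>j. s ^ p / fact p * damping n s j) (s ^ p / fact p * (4 / pi * arctan (exp (- s))))"
  \<comment> \<open>At \<open>s = 0\<close> the Poisson kernel degenerates, but the weight \<open>s ^ p\<close> vanishes there.\<close>
  proof (cases "s = 0")
    case True
    then show ?thesis using assms multiplier_bound_const[of 0] by (simp add: power_0_left)
  next
    case False
    then show ?thesis
      using s multiplier_bound_scale[OF damping_multiplier_bound[of s n], of "s ^ p / fact p"] assms
      by simp
  qed
qed (intro integrable_on_half_line_exp_bound continuous_on_damping damping_le arctan_exp_le
    continuous_intros; simp)+

lemma inverse_power_multiplier_high:
  assumes "n \<ge> 1" "j \<ge> n"
  shows "inverse_power_multiplier n p j = (real n / real j) ^ Suc p"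
proof -
  have "((\<lambda>s. s ^ p / fact p * exp (- (real j / real n * s))) has_integral
      1 / (real j / real n) ^ Suc p) {0..}"
    using assms by (intro power_exp_has_integral) auto
  then show ?thesis
    unfolding inverse_power_multiplier_def damping_high[OF assms]
    by (simp only: integral_unique mult.commute[of "real j / real n"] power_divide) simp
qed

section \<open>The secant as a sum of Favard constants\<close>

text \<open>
  The substitution \<open>x = exp s / (2 cosh s)\<close> maps the whole line onto the unit interval and turns the integral of
  \<open>exp (y s) / cosh s\<close> into the Beta integral with parameters \<open>(1 + y) / 2\<close> and \<open>(1 - y) / 2\<close>, which the reflection
  formula evaluates.
\<close>

lemma integral_cosh_ratio_le:
  assumes y: "0 \<le> y" "y < 1" and "R \<ge> 0"
  shows "integral {0..R} (\<lambda>s. cosh (y * s) / cosh s) \<le> pi / (2 * cos (pi * y / 2))"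
proof -
  define a where "a = (1 + y) / 2"
  define b where "b = (1 - y) / 2"
  have ab: "a > 0" "b > 0" "a + b = 1" "a - b = y" using y by (auto simp: a_def b_def field_simps)
  define G where "G s = exp s / (2 * cosh s)" for s :: real
  define \<beta> where "\<beta> x = x powr (a - 1) * (1 - x) powr (b - 1)" for x :: real
  have G1: "1 - G s = exp (- s) / (2 * cosh s)" for s
  proof -
    have "2 * cosh s = exp s + exp (- s)" by (simp add: cosh_def)
    moreover have "2 * cosh s \<noteq> 0" by simp
    ultimately show ?thesis unfolding G_def by (simp add: divide_simps)
  qed
  have G01: "0 < G s" "G s < 1" for s
  proof -
    show "0 < G s" unfolding G_def by simp
    have "0 < 1 - G s" unfolding G1 by simp
    then show "G s < 1" by simp
  qed
  have deriv: "(G has_real_derivative 2 * G s * (1 - G s)) (at s within A)" for s A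
  proof -
    have "(G has_real_derivative (exp s * (2 * cosh s) - exp s * (2 * sinh s)) / (2 * cosh s * (2 * cosh s))) (at s within A)"
      unfolding G_def by (auto intro!: derivative_eq_intros)
    moreover have "exp s * (2 * cosh s) - exp s * (2 * sinh s) = 2 * exp s * exp (- s)"
      by (simp add: cosh_minus_sinh[symmetric] algebra_simps)
    ultimately show ?thesis unfolding G1 unfolding G_def by (simp add: mult_ac)
  qed
  have "G t \<le> G s" if "t \<le> s" for s t
    using deriv G01 that
    by (intro DERIV_nonneg_imp_nondecreasing[OF that])
      (metis diff_ge_0_iff_ge less_imp_le mult_nonneg_nonneg zero_le_numeral)
  then have img: "G ` {- R..R} \<subseteq> {G (- R)..G R}" and le: "G (- R) \<le> G R"
    using \<open>R \<ge> 0\<close> by auto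
  have "continuous_on {G (- R)..G R} \<beta>"
    unfolding \<beta>_def using G01(1)[of "- R"] G01(2)[of R]
    by (intro continuous_intros) auto
  with img le have "((\<lambda>s. (2 * G s * (1 - G s)) *\<^sub>R \<beta> (G s)) has_integral integral {G (- R)..G R} \<beta>) {- R..R}"
    using \<open>R \<ge> 0\<close> by (intro has_integral_substitution deriv) auto
  moreover have "(2 * G s * (1 - G s)) *\<^sub>R \<beta> (G s) = exp (y * s) / cosh s" for s
  proof -
    have "(2 * G s * (1 - G s)) *\<^sub>R \<beta> (G s) = 2 * (G s powr a * (1 - G s) powr b)"
      using G01[of s] unfolding \<beta>_def by (simp add: powr_diff)
    also have "G s powr a * (1 - G s) powr b = exp (a * s) * exp (- (b * s)) / (2 * cosh s) powr (a + b)"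
      unfolding G1 unfolding G_def by (simp add: powr_divide powr_add exp_powr_real mult.commute)
    also have "exp (a * s) * exp (- (b * s)) = exp (y * s)"
      unfolding ab(4)[symmetric] by (simp add: exp_add[symmetric] algebra_simps)
    finally show ?thesis unfolding ab(3) by simp
  qed
  ultimately have "((\<lambda>s. exp (y * s) / cosh s) has_integral integral {G (- R)..G R} \<beta>) {- R..R}"
    by simp
  then have "integral {- R..R} (\<lambda>s. exp (y * s) / cosh s) = integral {G (- R)..G R} \<beta>"
    by (rule integral_unique)
  also have "\<dots> \<le> integral {0..1} \<beta>"
  proof (rule integral_subset_le)
    show "{G (- R)..G R} \<subseteq> {0..1}" using G01[of R] G01[of "- R"] by auto
    show "\<beta> integrable_on {0..1}" unfolding \<beta>_def using integrable_Beta'[OF ab(1,2)] by simp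
    show "\<beta> integrable_on {G (- R)..G R}"
      by (rule integrable_continuous_real) fact
  qed (simp add: \<beta>_def)
  also have "integral {0..1} \<beta> = Beta a b"
    unfolding \<beta>_def using has_integral_Beta_real[OF ab(1,2)] by (simp add: integral_unique)
  also have "\<dots> = Gamma a * Gamma (1 - a)"
  proof -
    have "b = 1 - a" using ab(3) by simp
    then show ?thesis by (simp add: Beta_def)
  qed
  also have "\<dots> = pi / sin (pi * a)"
  proof -
    have "complex_of_real (Gamma a * Gamma (1 - a)) = complex_of_real (pi / sin (pi * a))"
      using Gamma_reflection_complex[of "complex_of_real a"]
      by (simp add: Gamma_complex_of_real[symmetric] sin_of_real[symmetric])
    then show ?thesis by (simp only: of_real_eq_iff)
  qed
  also have "sin (pi * a) = cos (pi * y / 2)"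
    unfolding a_def by (simp add: sin_cos_eq add_divide_distrib distrib_left)
  finally have "integral {- R..R} (\<lambda>s. exp (y * s) / cosh s) \<le> pi / cos (pi * y / 2)" .
  moreover have "integral {- R..R} (\<lambda>s. exp (y * s) / cosh s) = 2 * integral {0..R} (\<lambda>s. cosh (y * s) / cosh s)"
  proof -
    have int: "(\<lambda>s. exp (z * s) / cosh s) integrable_on {u..v}" for z u v :: real
      by (intro integrable_continuous_real continuous_intros) auto
    have "integral {- R..R} (\<lambda>s. exp (y * s) / cosh s) =
        integral {- R..0} (\<lambda>s. exp (y * s) / cosh s) + integral {0..R} (\<lambda>s. exp (y * s) / cosh s)"
      using \<open>R \<ge> 0\<close> int by (intro Henstock_Kurzweil_Integration.integral_combine[symmetric]) auto
    also have "integral {- R..0} (\<lambda>s. exp (y * s) / cosh s) = integral {0..R} (\<lambda>s. exp (- y * s) / cosh s)"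
      using Henstock_Kurzweil_Integration.integral_reflect_real[of R 0 "\<lambda>s. exp (- y * s) / cosh s"] by simp
    also have "integral {0..R} (\<lambda>s. exp (- y * s) / cosh s) + integral {0..R} (\<lambda>s. exp (y * s) / cosh s) =
        integral {0..R} (\<lambda>s. exp (- y * s) / cosh s + exp (y * s) / cosh s)"
      by (rule integral_add[symmetric, OF int int])
    also have "\<dots> = integral {0..R} (\<lambda>s. 2 * (cosh (y * s) / cosh s))"
    proof (intro integral_cong)
      fix s
      have "exp (- y * s) + exp (y * s) = 2 * cosh (y * s)" by (simp add: cosh_def)
      then show "exp (- y * s) / cosh s + exp (y * s) / cosh s = 2 * (cosh (y * s) / cosh s)"
        by (simp add: add_divide_distrib[symmetric])
    qed
    also have "\<dots> = 2 * integral {0..R} (\<lambda>s. cosh (y * s) / cosh s)"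
      by (rule integral_mult_right)
    finally show ?thesis .
  qed
  ultimately show ?thesis by simp
qed

text \<open>
  The finite sum under the integral is dominated by \<open>y sinh (y s)\<close>, and the primitive \<open>F\<close> used below performs the
  integration by parts.  Its boundary value \<open>F R\<close> disappears only in the limit because \<open>y < 1\<close>.
\<close>

lemma sum_arctan_moments_le:
  assumes y: "0 \<le> y" "y < 1"
  shows "1 + (\<Sum>i<M. y ^ (2 * i + 2) * arctan_moment (2 * i + 1)) \<le> 1 / cos (pi * y / 2)"
proof -
  let ?at = "\<lambda>s. 4 / pi * arctan (exp (- s))"
  define h where "h s = (\<Sum>i<M. y ^ (2 * i + 2) * (s ^ (2 * i + 1) / fact (2 * i + 1) * ?at s))" for s
  have "(h has_integral (\<Sum>i<M. y ^ (2 * i + 2) * arctan_moment (2 * i + 1))) {0..}"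
    unfolding h_def arctan_moment_def
    by (intro has_integral_sum has_integral_mult_right integrable_integral
        integrable_on_half_line_exp_bound arctan_exp_le continuous_intros) auto
  then have h: "h integrable_on {0..}"
    "integral {0..} h = (\<Sum>i<M. y ^ (2 * i + 2) * arctan_moment (2 * i + 1))"
    by (auto simp: has_integral_iff)
  define F where "F s = cosh (y * s) * ?at s" for s
  have bound: "integral {0..R} h \<le> 1 / cos (pi * y / 2) - 1 + F R" if "R \<ge> 0" for R
  proof -
    have deriv: "(F has_real_derivative y * sinh (y * s) * ?at s - 2 / pi * (cosh (y * s) / cosh s))
        (at s within A)" for s A
    proof -
      have "((\<lambda>s. arctan (exp (- s))) has_real_derivative inverse (1 + (exp (- s))\<^sup>2) * (exp (- s) * -1)) (at s within A)"
        by (rule DERIV_chain2[OF DERIV_arctan]) (auto intro!: derivative_eq_intros)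
      moreover have "inverse (1 + (exp (- s))\<^sup>2) * (exp (- s) * -1) = - (1 / (2 * cosh s))"
      proof -
        have "1 + (exp (- s))\<^sup>2 = exp (- s) * (2 * cosh s)"
          by (simp add: cosh_def distrib_left exp_add[symmetric] power2_eq_square)
        then show ?thesis by (simp add: divide_simps)
      qed
      ultimately have "((\<lambda>s. arctan (exp (- s))) has_real_derivative - (1 / (2 * cosh s))) (at s within A)"
        by simp
      from DERIV_cmult[OF this, of "4 / pi"]
      have "((\<lambda>s. ?at s) has_real_derivative 4 / pi * - (1 / (2 * cosh s))) (at s within A)" .
      moreover have "((\<lambda>s. cosh (y * s)) has_real_derivative sinh (y * s) * y) (at s within A)"
        by (auto intro!: derivative_eq_intros)
      ultimately have "(F has_real_derivative
          sinh (y * s) * y * ?at s + 4 / pi * - (1 / (2 * cosh s)) * cosh (y * s)) (at s within A)"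
        unfolding F_def by (intro DERIV_mult)
      then show ?thesis by (simp add: mult_ac)
    qed
    have cosh_int: "(\<lambda>s. cosh (y * s) / cosh s) integrable_on {0..R}"
      by (intro integrable_continuous_real continuous_intros) auto
    have "((\<lambda>s. y * sinh (y * s) * ?at s - 2 / pi * (cosh (y * s) / cosh s)) has_integral F R - F 0) {0..R}"
      using that deriv by (intro fundamental_theorem_of_calculus)
        (auto simp: has_real_derivative_iff_has_vector_derivative[symmetric])
    from has_integral_add[OF this has_integral_mult_right[OF integrable_integral[OF cosh_int], of "2 / pi"]]
    have main: "((\<lambda>s. y * sinh (y * s) * ?at s) has_integral
        F R - F 0 + 2 / pi * integral {0..R} (\<lambda>s. cosh (y * s) / cosh s)) {0..R}"
      by simp
    have "integral {0..R} h \<le> F R - F 0 + 2 / pi * integral {0..R} (\<lambda>s. cosh (y * s) / cosh s)"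
    proof (rule has_integral_le[OF _ main])
      show "(h has_integral integral {0..R} h) {0..R}"
        unfolding h_def by (intro integrable_integral integrable_continuous_real continuous_intros) auto
      fix s :: real assume s: "s \<in> {0..R}"
      have "(\<Sum>i<M. (y * s) ^ (2 * i + 1) / fact (2 * i + 1)) \<le> sinh (y * s)"
      proof -
        let ?t = "\<lambda>n. if even n then 0 else (y * s) ^ n /\<^sub>R fact n"
        have "?t sums sinh (y * s)" by (rule sinh_converges)
        moreover have "(\<Sum>i<M. (y * s) ^ (2 * i + 1) / fact (2 * i + 1)) = sum ?t ((\<lambda>i. 2 * i + 1) ` {..<M})"
          by (subst sum.reindex) (auto simp: inj_on_def divide_inverse mult.commute)
        moreover have "sum ?t ((\<lambda>i. 2 * i + 1) ` {..<M}) \<le> suminf ?t"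
          using y s \<open>?t sums sinh (y * s)\<close> by (intro sum_le_suminf) (auto simp: sums_iff)
        ultimately show ?thesis by (simp add: sums_iff)
      qed
      then have "(\<Sum>i<M. (y * s) ^ (2 * i + 1) / fact (2 * i + 1)) * (y * ?at s) \<le> sinh (y * s) * (y * ?at s)"
        using y by (intro mult_right_mono) auto
      moreover have "h s = (\<Sum>i<M. (y * s) ^ (2 * i + 1) / fact (2 * i + 1)) * (y * ?at s)"
        unfolding h_def sum_distrib_right
        by (intro sum.cong refl) (simp add: power_mult_distrib algebra_simps)
      ultimately show "h s \<le> y * sinh (y * s) * ?at s" by (simp add: mult_ac)
    qed
    also have "F 0 = 1" unfolding F_def by simp
    also have "2 / pi * integral {0..R} (\<lambda>s. cosh (y * s) / cosh s) \<le> 2 / pi * (pi / (2 * cos (pi * y / 2)))"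
      using integral_cosh_ratio_le[OF y that] by (intro mult_left_mono) auto
    finally show ?thesis by simp
  qed
  have "(F \<longlongrightarrow> 0) at_top"
  proof (rule Lim_null_comparison)
    show "\<forall>\<^sub>F s in at_top. norm (F s) \<le> 2 * exp ((y - 1) * s)"
      using eventually_ge_at_top[of 0]
    proof eventually_elim
      case (elim s)
      have "cosh (y * s) \<le> exp (y * s)" using y elim by (simp add: cosh_def)
      then have "norm (F s) \<le> exp (y * s) * (2 * exp (- s))"
        unfolding F_def real_norm_def abs_mult[of "cosh (y * s)"]
        by (intro mult_mono arctan_exp_le) auto
      then show ?case by (simp add: exp_add[symmetric] algebra_simps)
    qed
    show "((\<lambda>s. 2 * exp ((y - 1) * s)) \<longlongrightarrow> 0) at_top" using y by real_asymp
  qed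
  from tendsto_add[OF tendsto_const this, of "1 / cos (pi * y / 2) - 1"]
  have "((\<lambda>R. 1 / cos (pi * y / 2) - 1 + F R) \<longlongrightarrow> 1 / cos (pi * y / 2) - 1) at_top" by simp
  then have "integral {0..} h \<le> 1 / cos (pi * y / 2) - 1"
    using bound
    by (intro tendsto_le[OF _ _ tendsto_integral_half_line[OF h(1)]])
      (auto intro: eventually_mono[OF eventually_ge_at_top[of 0]])
  then show ?thesis using h(2) by simp
qed

section \<open>Averaged differences as multipliers\<close>

lemma odd_inverse_squares_le: "(\<Sum>j<J. 1 / (2 * real j + 1)\<^sup>2) \<le> pi\<^sup>2 / 8"
proof -
  define H where "H N = (\<Sum>i<N. 1 / (real i + 1)\<^sup>2)" for N
  have split: "(\<Sum>j<J. 1 / (2 * real j + 1)\<^sup>2) = H (2 * J) - H J / 4" for J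
  proof (induction J)
    case (Suc J)
    have "H (2 * Suc J) = H (2 * J) + 1 / (2 * real J + 1)\<^sup>2 + 1 / (2 * real J + 2)\<^sup>2"
      unfolding H_def by (simp add: algebra_simps)
    moreover have "(2 * real J + 2)\<^sup>2 = 4 * (real J + 1)\<^sup>2" by (simp add: power2_eq_square algebra_simps)
    moreover have "H (Suc J) = H J + 1 / (real J + 1)\<^sup>2" unfolding H_def by simp
    ultimately show ?case using Suc by (simp add: add_divide_distrib)
  qed (simp add: H_def)
  have H: "H \<longlonglongrightarrow> pi\<^sup>2 / 6"
    using inverse_squares_sums unfolding H_def sums_def by (simp add: add.commute)
  then have "(\<lambda>J. H (2 * J)) \<longlonglongrightarrow> pi\<^sup>2 / 6"
    using LIMSEQ_subseq_LIMSEQ[OF H, of "\<lambda>J. 2 * J"] by (simp add: strict_mono_def o_def)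
  from tendsto_diff[OF this tendsto_divide[OF H tendsto_const[of 4]]]
  have "(\<lambda>J. \<Sum>j<J. 1 / (2 * real j + 1)\<^sup>2) \<longlonglongrightarrow> pi\<^sup>2 / 8"
    unfolding split by simp
  moreover have "incseq (\<lambda>J. \<Sum>j<J. 1 / (2 * real j + 1)\<^sup>2)"
    by (intro incseq_SucI) simp
  ultimately show ?thesis by (rule incseq_le[rotated])
qed

lemma even_inverse_squares_le: "(\<Sum>j<J. 1 / (2 * real j + 2)\<^sup>2) \<le> pi\<^sup>2 / 8"
proof -
  have "(\<Sum>j<J. 1 / (2 * real j + 2)\<^sup>2) \<le> (\<Sum>j<J. 1 / (2 * real j + 1)\<^sup>2)"
    by (intro sum_mono divide_left_mono power_mono mult_pos_pos zero_less_power) auto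
  then show ?thesis using odd_inverse_squares_le[of J] by linarith
qed

lemma inverse_squares_parity_le:
  fixes k :: nat and P :: "nat \<Rightarrow> bool"
  assumes "P = even \<or> P = odd"
  shows "(\<Sum>i\<in>{i\<in>{1..k}. P i}. 1 / (real i)\<^sup>2) \<le> pi\<^sup>2 / 8"
  using assms
proof
  assume P: "P = even"
  have "{i\<in>{1..k}. P i} \<subseteq> (\<lambda>j. 2 * j + 2) ` {..<k}"
  proof
    fix i assume "i \<in> {i\<in>{1..k}. P i}"
    then have "i = 2 * (i div 2 - 1) + 2" "i div 2 - 1 < k" unfolding P by auto
    then show "i \<in> (\<lambda>j. 2 * j + 2) ` {..<k}" by blast
  qed
  then have "(\<Sum>i\<in>{i\<in>{1..k}. P i}. 1 / (real i)\<^sup>2) \<le> (\<Sum>i\<in>(\<lambda>j. 2 * j + 2) ` {..<k}. 1 / (real i)\<^sup>2)"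
    by (intro sum_mono2) auto
  also have "\<dots> = (\<Sum>j<k. 1 / (2 * real j + 2)\<^sup>2)"
    by (subst sum.reindex) (auto simp: inj_on_def add.commute)
  finally show ?thesis using even_inverse_squares_le[of k] by linarith
next
  assume P: "P = odd"
  have "{i\<in>{1..k}. P i} \<subseteq> (\<lambda>j. 2 * j + 1) ` {..<k}"
  proof
    fix i assume "i \<in> {i\<in>{1..k}. P i}"
    then have "i = 2 * (i div 2) + 1" "i div 2 < k" unfolding P by auto
    then show "i \<in> (\<lambda>j. 2 * j + 1) ` {..<k}" by blast
  qed
  then have "(\<Sum>i\<in>{i\<in>{1..k}. P i}. 1 / (real i)\<^sup>2) \<le> (\<Sum>i\<in>(\<lambda>j. 2 * j + 1) ` {..<k}. 1 / (real i)\<^sup>2)"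
    by (intro sum_mono2) auto
  also have "\<dots> = (\<Sum>j<k. 1 / (2 * real j + 1)\<^sup>2)"
    by (subst sum.reindex) (auto simp: inj_on_def add.commute)
  finally show ?thesis using odd_inverse_squares_le[of k] by linarith
qed

text \<open>
  The normalised coefficients of the central difference of order \<open>2 k\<close>; the centre \<open>i = k\<close> has weight one.
\<close>

definition difference_weight :: "nat \<Rightarrow> nat \<Rightarrow> real" where
  "difference_weight k i = (- 1) ^ (i + k) * gamma_star_even k * real ((2 * k) choose i)"

lemma difference_weight_center: "difference_weight k k = 1"
proof -
  have "real ((2 * k) choose k) \<noteq> 0" by simp
  then show ?thesis unfolding difference_weight_def gamma_star_even_def by (simp add: mult_2[symmetric])
qed

lemma abs_difference_weight_le: "\<bar>difference_weight k i\<bar> \<le> 1"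
proof -
  have "real ((2 * k) choose i) \<le> real ((2 * k) choose k)"
    using binomial_maximum'[of k i] by simp
  moreover have "real ((2 * k) choose k) > 0" by simp
  ultimately show ?thesis
    unfolding difference_weight_def gamma_star_even_def by (simp add: abs_mult power_abs field_simps)
qed

lemma sum_two_sided_parity_le:
  fixes k :: nat and w :: "nat \<Rightarrow> real"
  assumes P: "P = even \<or> P = odd" and w: "\<And>i. \<bar>w i\<bar> \<le> 1"
  shows "(\<Sum>i\<in>{i\<in>{..2*k} - {k}. P (i + k)}. \<bar>w i\<bar> / (real i - real k)\<^sup>2) \<le> pi\<^sup>2 / 4"
proof -
  let ?D = "{d\<in>{1..k}. P d}"
  have par: "P (k - d + k) = P d" "P (k + d + k) = P d" if "d \<le> k" for d
    using P that by auto
  have "{i\<in>{..2*k} - {k}. P (i + k)} \<subseteq> (\<lambda>d. k - d) ` ?D \<union> (\<lambda>d. k + d) ` ?D"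
  proof
    fix i assume i: "i \<in> {i\<in>{..2*k} - {k}. P (i + k)}"
    show "i \<in> (\<lambda>d. k - d) ` ?D \<union> (\<lambda>d. k + d) ` ?D"
    proof (cases "i < k")
      case True
      then have "i = k - (k - i)" "k - i \<in> ?D" using i par(1)[of "k - i"] by auto
      then show ?thesis by blast
    next
      case False
      then have "i = k + (i - k)" "i - k \<in> ?D" using i par(2)[of "i - k"] by auto
      then show ?thesis by blast
    qed
  qed
  then have "(\<Sum>i\<in>{i\<in>{..2*k} - {k}. P (i + k)}. \<bar>w i\<bar> / (real i - real k)\<^sup>2) \<le>
      (\<Sum>i\<in>(\<lambda>d. k - d) ` ?D \<union> (\<lambda>d. k + d) ` ?D. 1 / (real i - real k)\<^sup>2)"
    using w by (intro order_trans[OF sum_mono sum_mono2]) (auto intro: divide_right_mono)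
  also have "\<dots> \<le> (\<Sum>i\<in>(\<lambda>d. k - d) ` ?D. 1 / (real i - real k)\<^sup>2) +
      (\<Sum>i\<in>(\<lambda>d. k + d) ` ?D. 1 / (real i - real k)\<^sup>2)"
    by (subst sum.union_inter[symmetric]) (auto intro: sum_nonneg)
  also have "(\<Sum>i\<in>(\<lambda>d. k - d) ` ?D. 1 / (real i - real k)\<^sup>2) = (\<Sum>d\<in>?D. 1 / (real d)\<^sup>2)"
    by (subst sum.reindex) (auto simp: inj_on_def of_nat_diff intro!: sum.cong)
  also have "(\<Sum>i\<in>(\<lambda>d. k + d) ` ?D. 1 / (real i - real k)\<^sup>2) = (\<Sum>d\<in>?D. 1 / (real d)\<^sup>2)"
    by (subst sum.reindex) (auto simp: inj_on_def)
  finally show ?thesis using inverse_squares_parity_le[OF P, of k] by simp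
qed

text \<open>
  The factor \<open>S\<close> in \<open>1 - S j (n / j)\<^sup>2\<close>, the multiplier of the averaged differences.  The quotient by \<open>(i - k)\<^sup>2\<close> comes
  from integrating a cosine of frequency proportional to \<open>i - k\<close> twice.
\<close>

definition averaging_defect :: "nat \<Rightarrow> real \<Rightarrow> real \<Rightarrow> nat \<Rightarrow> real" where
  "averaging_defect k y h j = - (2 * y\<^sup>2 / pi\<^sup>2) * (\<Sum>i\<in>{..2*k} - {k}.
     difference_weight k i / (real i - real k)\<^sup>2 * (1 - cos (2 * pi * real j * ((real i - real k) * h))))"

text \<open>
  With coefficients \<open>e i\<close> that have the sign of \<open>(-1)\<^sup>i\<^sup>+\<^sup>k\<close>, the constant term contributes \<open>\<bar>A - B\<bar>\<close> and the shifts contribute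
  \<open>A + B\<close>, where \<open>A\<close> and \<open>B\<close> are the total weights of the even and the odd offsets.  The sum is \<open>2 max A B\<close>, so only
  one parity counts.
\<close>

lemma averaging_defect_bound: "multiplier_bound (averaging_defect k y h) (y\<^sup>2)"
proof -
  let ?I = "{..2*k} - {k}"
  define e where "e i = difference_weight k i / (real i - real k)\<^sup>2" for i
  define A where "A = (\<Sum>i\<in>{i\<in>?I. even (i + k)}. \<bar>e i\<bar>)"
  define B where "B = (\<Sum>i\<in>{i\<in>?I. odd (i + k)}. \<bar>e i\<bar>)"
  have e_abs: "\<bar>e i\<bar> = \<bar>difference_weight k i\<bar> / (real i - real k)\<^sup>2" for i
    unfolding e_def by simp
  have AB: "A \<le> pi\<^sup>2 / 4" "B \<le> pi\<^sup>2 / 4"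
    unfolding A_def B_def e_abs
    by (intro sum_two_sided_parity_le abs_difference_weight_le; simp)+
  have sgn: "e i = (if even (i + k) then \<bar>e i\<bar> else - \<bar>e i\<bar>)" for i
    unfolding e_def difference_weight_def gamma_star_even_def by simp
  have split: "(\<Sum>i\<in>?I. g i) = (\<Sum>i\<in>{i\<in>?I. even (i + k)}. g i) + (\<Sum>i\<in>{i\<in>?I. odd (i + k)}. g i)"
    for g :: "nat \<Rightarrow> real"
    by (subst sum.union_disjoint[symmetric]) (auto intro: sum.cong)
  have sum_e: "(\<Sum>i\<in>?I. e i) = A - B"
    unfolding split A_def B_def sum_negf[symmetric] diff_conv_add_uminus
    by (intro arg_cong2[where f = "(+)"] sum.cong refl) (subst sgn; simp)+
  have sum_abs_e: "(\<Sum>i\<in>?I. \<bar>e i\<bar>) = A + B" unfolding split A_def B_def by simp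
  have "multiplier_bound (\<lambda>j. (\<Sum>i\<in>?I. e i) + (\<Sum>i\<in>?I. - e i * cos (2 * pi * real j * ((real i - real k) * h))))
      (\<bar>\<Sum>i\<in>?I. e i\<bar> + (\<Sum>i\<in>?I. \<bar>- e i\<bar> * 1))"
    by (intro multiplier_bound_add multiplier_bound_const multiplier_bound_sum
        multiplier_bound_scale multiplier_bound_cos)
  then have bound: "multiplier_bound (\<lambda>j. - (2 * y\<^sup>2 / pi\<^sup>2) *
      ((\<Sum>i\<in>?I. e i) + (\<Sum>i\<in>?I. - e i * cos (2 * pi * real j * ((real i - real k) * h)))))
      (\<bar>- (2 * y\<^sup>2 / pi\<^sup>2)\<bar> * (\<bar>\<Sum>i\<in>?I. e i\<bar> + (\<Sum>i\<in>?I. \<bar>- e i\<bar> * 1)))"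
    by (rule multiplier_bound_scale)
  have eq: "averaging_defect k y h = (\<lambda>j. - (2 * y\<^sup>2 / pi\<^sup>2) *
      ((\<Sum>i\<in>?I. e i) + (\<Sum>i\<in>?I. - e i * cos (2 * pi * real j * ((real i - real k) * h)))))"
    unfolding averaging_defect_def e_def[symmetric] sum.distrib[symmetric]
    by (simp add: algebra_simps)
  have "\<bar>- (2 * y\<^sup>2 / pi\<^sup>2)\<bar> * (\<bar>\<Sum>i\<in>?I. e i\<bar> + (\<Sum>i\<in>?I. \<bar>- e i\<bar> * 1)) \<le> y\<^sup>2"
  proof -
    have "\<bar>\<Sum>i\<in>?I. e i\<bar> + (\<Sum>i\<in>?I. \<bar>- e i\<bar> * 1) \<le> pi\<^sup>2 / 2"
    proof -
      have "(\<Sum>i\<in>?I. \<bar>- e i\<bar> * 1) = A + B" using sum_abs_e by simp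
      then show ?thesis unfolding sum_e using AB by linarith
    qed
    then have "\<bar>- (2 * y\<^sup>2 / pi\<^sup>2)\<bar> * (\<bar>\<Sum>i\<in>?I. e i\<bar> + (\<Sum>i\<in>?I. \<bar>- e i\<bar> * 1)) \<le>
        \<bar>- (2 * y\<^sup>2 / pi\<^sup>2)\<bar> * (pi\<^sup>2 / 2)" by (rule mult_left_mono) simp
    then show ?thesis by simp
  qed
  with bound show ?thesis unfolding eq by (rule multiplier_bound_mono)
qed

lemma averaged_cos_has_integral:
  fixes h c :: real
  assumes h: "h > 0" and c: "c \<noteq> 0"
  shows "((\<lambda>t. 2 / h\<^sup>2 * (h - t) * cos (c * t)) has_integral 2 * (1 - cos (c * h)) / (c * h)\<^sup>2) {0..h}"
proof -
  let ?F = "\<lambda>t. 2 / h\<^sup>2 * ((h - t) * sin (c * t) / c - cos (c * t) / c\<^sup>2)"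
  have "(?F has_real_derivative 2 / h\<^sup>2 * (h - t) * cos (c * t)) (at t within A)" for t A
    using h c by (auto intro!: derivative_eq_intros simp: field_simps power2_eq_square)
  then have "((\<lambda>t. 2 / h\<^sup>2 * (h - t) * cos (c * t)) has_integral ?F h - ?F 0) {0..h}"
    using h by (intro fundamental_theorem_of_calculus)
      (auto simp: has_real_derivative_iff_has_vector_derivative[symmetric])
  moreover have "?F h - ?F 0 = 2 * (1 - cos (c * h)) / (c * h)\<^sup>2"
    using h c by (simp add: field_simps power2_eq_square)
  ultimately show ?thesis by simp
qed

lemma averaged_one_has_integral:
  fixes h :: real
  assumes "h > 0"
  shows "((\<lambda>t. 2 / h\<^sup>2 * (h - t)) has_integral 1) {0..h}"
proof -
  let ?F = "\<lambda>t. 2 / h\<^sup>2 * (h * t - t\<^sup>2 / 2)"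
  have "(?F has_real_derivative 2 / h\<^sup>2 * (h - t)) (at t within A)" for t A
  proof (rule DERIV_cmult)
    show "((\<lambda>t. h * t - t\<^sup>2 / 2) has_real_derivative h - t) (at t within A)"
      by (auto intro!: derivative_eq_intros)
  qed
  then have "((\<lambda>t. 2 / h\<^sup>2 * (h - t)) has_integral ?F h - ?F 0) {0..h}"
    using assms by (intro fundamental_theorem_of_calculus)
      (auto simp: has_real_derivative_iff_has_vector_derivative[symmetric])
  moreover have "?F h - ?F 0 = 1" using assms by (simp add: field_simps power2_eq_square)
  ultimately show ?thesis by simp
qed

definition difference_multiplier :: "nat \<Rightarrow> real \<Rightarrow> nat \<Rightarrow> real" where
  "difference_multiplier k t j =
     (\<Sum>i\<le>2*k. difference_weight k i * cos (2 * pi * real j * ((real i - real k) * t)))"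

text \<open>
  The weights are symmetric about \<open>k\<close>, so the difference centred at \<open>x\<close> is unchanged by reversing the sign of the step, and
  the average of both orientations is a multiplier.
\<close>

lemma trig_sum_difference_multiplier:
  "trig_sum N (\<lambda>j. difference_multiplier k t j * a j) (\<lambda>j. difference_multiplier k t j * b j) x =
     (- 1) ^ k * gamma_star_even k * fin_diff (2 * k) t (trig_sum N a b) (x - real k * t)"
proof -
  let ?P = "trig_sum N a b" and ?w = "difference_weight k"
  define L where "L = (\<Sum>i\<le>2*k. ?w i * ?P (x + (real i - real k) * t))"
  have refl': "L = (\<Sum>i\<le>2*k. ?w i * ?P (x - (real i - real k) * t))"
  proof -
    have "L = (\<Sum>i\<le>2*k. ?w (2*k - i) * ?P (x + (real (2*k - i) - real k) * t))"
      using sum.atLeastAtMost_rev[of "\<lambda>i. ?w i * ?P (x + (real i - real k) * t)" 0 "2*k"]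
      by (simp add: L_def atMost_atLeast0)
    also have "\<dots> = (\<Sum>i\<le>2*k. ?w i * ?P (x - (real i - real k) * t))"
    proof (intro sum.cong refl)
      fix i assume i: "i \<in> {..2*k}"
      then have "?w (2*k - i) = ?w i"
        unfolding difference_weight_def by (auto simp: binomial_symmetric[symmetric] minus_one_power_iff)
      moreover have "x + (real (2*k - i) - real k) * t = x - (real i - real k) * t"
        using i by (simp add: of_nat_diff algebra_simps)
      ultimately show "?w (2*k - i) * ?P (x + (real (2*k - i) - real k) * t) =
          ?w i * ?P (x - (real i - real k) * t)" by simp
    qed
    finally show ?thesis .
  qed
  have sum_lin: "trig_sum N (\<lambda>j. (\<Sum>i\<in>I. c i j) * a j) (\<lambda>j. (\<Sum>i\<in>I. c i j) * b j) x =
      (\<Sum>i\<in>I. trig_sum N (\<lambda>j. c i j * a j) (\<lambda>j. c i j * b j) x)" if "finite I" for I and c :: "nat \<Rightarrow> nat \<Rightarrow> real"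
    using that
  proof induction
    case empty
    show ?case by (simp add: trig_sum_def)
  next
    case (insert i I)
    then show ?case by (simp add: distrib_right trig_sum_add[symmetric])
  qed
  have "trig_sum N (\<lambda>j. difference_multiplier k t j * a j) (\<lambda>j. difference_multiplier k t j * b j) x =
      (\<Sum>i\<le>2*k. ?w i * ((?P (x + (real i - real k) * t) + ?P (x - (real i - real k) * t)) / 2))"
    unfolding difference_multiplier_def
    by (subst sum_lin) (auto simp: trig_sum_symmetric_shift trig_sum_scale mult.assoc)
  also have "\<dots> = (L + (\<Sum>i\<le>2*k. ?w i * ?P (x - (real i - real k) * t))) / 2"
    unfolding L_def sum.distrib[symmetric] sum_divide_distrib
    by (simp add: algebra_simps add_divide_distrib)
  also have "\<dots> = L" unfolding refl'[symmetric] by simp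
  also have "L = (- 1) ^ k * gamma_star_even k * fin_diff (2 * k) t ?P (x - real k * t)"
    unfolding L_def fin_diff_def sum_distrib_left atMost_atLeast0[symmetric]
    by (intro sum.cong refl) (simp add: difference_weight_def power_add algebra_simps)
  finally show ?thesis .
qed

text \<open>
  The density \<open>2 (h - t) / h\<^sup>2\<close> has mass one on \<open>[0, h]\<close>.  It is the weight for which a cosine integrates to a constant
  times \<open>(1 - cos) / j\<^sup>2\<close>, which produces the factor \<open>(n / j)\<^sup>2\<close>.
\<close>

definition averaged_multiplier :: "nat \<Rightarrow> real \<Rightarrow> nat \<Rightarrow> real" where
  "averaged_multiplier k h j =
     integral {0..h} (\<lambda>t. 2 / h\<^sup>2 * (h - t) * difference_multiplier k t j)"

lemma averaged_multiplier_eq: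
  assumes n: "n \<ge> 1" and j: "j \<ge> 1" and \<alpha>: "\<alpha> > 0" and h: "h = \<alpha> / (2 * real n)"
  shows "averaged_multiplier k h j = 1 - averaging_defect k (1 / \<alpha>) h j * (real n / real j)\<^sup>2"
proof -
  have hpos: "h > 0" using n \<alpha> h by simp
  let ?w = "difference_weight k" and ?I = "{..2*k} - {k}"
  have split: "(\<Sum>i\<le>2*k. g i) = g k + (\<Sum>i\<in>?I. g i)" for g :: "nat \<Rightarrow> real"
    by (rule sum.remove) auto
  have "((\<lambda>t. 2 / h\<^sup>2 * (h - t) + (\<Sum>i\<in>?I. ?w i * (2 / h\<^sup>2 * (h - t) * cos (2 * pi * real j * (real i - real k) * t))))
      has_integral 1 + (\<Sum>i\<in>?I. ?w i * (2 * (1 - cos (2 * pi * real j * (real i - real k) * h)) /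
        (2 * pi * real j * (real i - real k) * h)\<^sup>2))) {0..h}"
    using j hpos
    by (intro has_integral_add has_integral_sum has_integral_mult_right averaged_one_has_integral
        averaged_cos_has_integral) auto
  moreover have "2 / h\<^sup>2 * (h - t) + (\<Sum>i\<in>?I. ?w i * (2 / h\<^sup>2 * (h - t) * cos (2 * pi * real j * (real i - real k) * t))) =
      2 / h\<^sup>2 * (h - t) * difference_multiplier k t j" for t
    unfolding difference_multiplier_def split difference_weight_center distrib_left sum_distrib_left
    by (simp add: mult_ac)
  ultimately have "averaged_multiplier k h j = 1 + (\<Sum>i\<in>?I. ?w i * (2 * (1 - cos (2 * pi * real j * (real i - real k) * h)) /
        (2 * pi * real j * (real i - real k) * h)\<^sup>2))"
    unfolding averaged_multiplier_def by (simp only: integral_unique)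
  also have "(\<Sum>i\<in>?I. ?w i * (2 * (1 - cos (2 * pi * real j * (real i - real k) * h)) /
        (2 * pi * real j * (real i - real k) * h)\<^sup>2)) = - (averaging_defect k (1 / \<alpha>) h j * (real n / real j)\<^sup>2)"
  proof -
    have "?w i * (2 * (1 - cos (2 * pi * real j * (real i - real k) * h)) / (2 * pi * real j * (real i - real k) * h)\<^sup>2) =
        (2 * (1 / \<alpha>)\<^sup>2 / pi\<^sup>2) * (real n / real j)\<^sup>2 *
          (?w i / (real i - real k)\<^sup>2 * (1 - cos (2 * pi * real j * ((real i - real k) * h))))" if "i \<in> ?I" for i
    proof -
      define d where "d = real i - real k"
      define C where "C = cos (2 * pi * real j * d * h)"
      have "2 * pi * real j * d * h = pi * real j * d * \<alpha> / real n"
        using n unfolding h by simp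
      then have "(2 * pi * real j * d * h)\<^sup>2 = pi\<^sup>2 * (real j)\<^sup>2 * d\<^sup>2 * \<alpha>\<^sup>2 / (real n)\<^sup>2"
        by (simp only: power_mult_distrib power_divide)
      moreover have "2 * pi * real j * (d * h) = 2 * pi * real j * d * h" by simp
      moreover have "?w i * (2 * (1 - C) / (pi\<^sup>2 * (real j)\<^sup>2 * d\<^sup>2 * \<alpha>\<^sup>2 / (real n)\<^sup>2)) =
          (2 * (1 / \<alpha>)\<^sup>2 / pi\<^sup>2) * (real n / real j)\<^sup>2 * (?w i / d\<^sup>2 * (1 - C))"
        by (simp add: power_divide mult_ac)
      ultimately show ?thesis unfolding d_def[symmetric] C_def by (simp only:)
    qed
    then show ?thesis
      unfolding averaging_defect_def sum_distrib_left sum_distrib_right sum_negf[symmetric]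
      by (intro sum.cong refl) (simp add: mult_ac)
  qed
  finally show ?thesis by simp
qed

section \<open>Best approximation and the modulus of smoothness\<close>

lemma multiplier_bound_imp_abs_le:
  assumes "multiplier_bound c C"
  shows "\<bar>c j\<bar> \<le> C"
proof -
  have *: "trig_sum (Suc j) (\<lambda>i. d i * (if i = j then 1 else 0)) (\<lambda>i. d i * 0) x = d j * cos (2 * pi * real j * x)" for d x
    unfolding trig_sum_def by (simp add: if_distrib[of "\<lambda>u. _ * u"] if_distrib[of "\<lambda>u. u * _"] cong: if_cong)
  have "\<bar>trig_sum (Suc j) (\<lambda>i. if i = j then 1 else 0) (\<lambda>i. 0) x\<bar> \<le> 1" for x
    using *[of "\<lambda>_. 1" x] by simp
  from multiplier_boundD[OF assms this, of 0] show ?thesis using *[of c 0] by simp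
qed

lemma trig_sum_in_trig_polys:
  assumes "\<And>j. j \<ge> n \<Longrightarrow> a j = 0 \<and> b j = 0"
  shows "trig_sum N a b \<in> trig_polys n"
proof -
  define a' where "a' j = (if j < N then a j else 0)" for j
  define b' where "b' j = (if j < N then b j else 0)" for j
  have "trig_sum N a b x = (\<Sum>j\<in>{0..<n}. a' j * cos (2 * pi * real j * x)) +
      (\<Sum>j\<in>{1..<n}. b' j * sin (2 * pi * real j * x))" for x
  proof -
    have "trig_sum N a b x = trig_sum (max N n) a' b' x"
      unfolding a'_def b'_def by (rule trig_sum_pad) simp
    also have "\<dots> = (\<Sum>j\<in>{0..<n}. a' j * cos (2 * pi * real j * x) + b' j * sin (2 * pi * real j * x))"
      unfolding trig_sum_def by (intro sum.mono_neutral_right) (auto simp: a'_def b'_def assms)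
    also have "\<dots> = (\<Sum>j\<in>{0..<n}. a' j * cos (2 * pi * real j * x)) +
        (\<Sum>j\<in>{0..<n}. b' j * sin (2 * pi * real j * x))" by (rule sum.distrib)
    also have "(\<Sum>j\<in>{0..<n}. b' j * sin (2 * pi * real j * x)) = (\<Sum>j\<in>{1..<n}. b' j * sin (2 * pi * real j * x))"
      by (intro sum.mono_neutral_right) (auto simp: Suc_le_eq)
    finally show ?thesis .
  qed
  then show ?thesis unfolding trig_polys_def by blast
qed

lemma bounded_C_T:
  assumes "f \<in> C_T"
  shows "\<exists>B. \<forall>x. \<bar>f x\<bar> \<le> B"
proof -
  have "continuous_on {0..1} f" "\<And>x m. f (x + of_int m) = f x"
    using assms periodic_int[of f] unfolding C_T_def by (auto intro: continuous_on_subset)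
  then have "bounded (f ` {0..1})" by (intro compact_imp_bounded compact_continuous_image) auto
  then obtain B where B: "\<forall>x\<in>{0..1}. \<bar>f x\<bar> \<le> B"
    unfolding bounded_iff by auto
  have "\<bar>f x\<bar> \<le> B" for x
  proof -
    have "f x = f (frac x)"
      using \<open>\<And>x m. f (x + of_int m) = f x\<close>[of "frac x" "\<lfloor>x\<rfloor>"] by (simp add: frac_def)
    then show ?thesis using B by (simp add: frac_ge_0 frac_lt_1 less_imp_le)
  qed
  then show ?thesis by blast
qed

lemma bounded_trig_polys:
  assumes "\<tau> \<in> trig_polys n"
  shows "\<exists>B. \<forall>x. \<bar>\<tau> x\<bar> \<le> B"
proof -
  obtain a b where \<tau>: "\<And>x. \<tau> x = (\<Sum>j\<in>{0..<n}. a j * cos (2 * pi * real j * x)) +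
      (\<Sum>j\<in>{1..<n}. b j * sin (2 * pi * real j * x))"
    using assms unfolding trig_polys_def by blast
  have "\<bar>\<tau> x\<bar> \<le> (\<Sum>j\<in>{0..<n}. \<bar>a j\<bar>) + (\<Sum>j\<in>{1..<n}. \<bar>b j\<bar>)" for x
    unfolding \<tau>
    by (intro order_trans[OF abs_triangle_ineq] add_mono order_trans[OF sum_abs] sum_mono)
      (simp_all add: abs_mult mult_left_le)
  then show ?thesis by blast
qed

lemma best_approx_le:
  assumes f: "f \<in> C_T" and \<tau>: "\<tau> \<in> trig_polys n" and le: "\<And>x. \<bar>f x - \<tau> x\<bar> \<le> B"
  shows "best_approx n f \<le> B"
  unfolding best_approx_def
proof (rule cINF_lower2[OF _ \<tau>])
  show "sup_norm (\<lambda>x. f x - \<tau> x) \<le> B"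
    unfolding sup_norm_def using le by (intro cSUP_least) auto
  show "bdd_below ((\<lambda>\<tau>. sup_norm (\<lambda>x. f x - \<tau> x)) ` trig_polys n)"
  proof (rule bdd_belowI2)
    fix \<sigma> assume \<sigma>: "\<sigma> \<in> trig_polys n"
    obtain A where A: "\<forall>x. \<bar>f x\<bar> \<le> A" using bounded_C_T[OF f] by blast
    obtain A' where A': "\<forall>x. \<bar>\<sigma> x\<bar> \<le> A'" using bounded_trig_polys[OF \<sigma>] by blast
    have "bdd_above (range (\<lambda>x. \<bar>f x - \<sigma> x\<bar>))"
    proof (rule bdd_aboveI2)
      fix x show "\<bar>f x - \<sigma> x\<bar> \<le> A + A'" using A[rule_format, of x] A'[rule_format, of x] by linarith
    qed
    then have "\<bar>f 0 - \<sigma> 0\<bar> \<le> sup_norm (\<lambda>x. f x - \<sigma> x)"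
      unfolding sup_norm_def by (intro cSUP_upper) auto
    then show "0 \<le> sup_norm (\<lambda>x. f x - \<sigma> x)" by linarith
  qed
qed

lemma abs_fin_diff_le:
  assumes "\<And>x. \<bar>g x\<bar> \<le> B"
  shows "\<bar>fin_diff r t g x\<bar> \<le> 2 ^ r * B"
proof -
  have "\<bar>fin_diff r t g x\<bar> \<le> (\<Sum>j=0..r. real (r choose j) * B)"
    unfolding fin_diff_def
    by (intro order_trans[OF sum_abs] sum_mono) (simp add: abs_mult mult_left_mono assms)
  also have "\<dots> = 2 ^ r * B"
    using choose_row_sum[of r] unfolding sum_distrib_right[symmetric] atLeast0AtMost
    by (metis of_nat_numeral of_nat_power of_nat_sum)
  finally show ?thesis .
qed

lemma fin_diff_diff: "fin_diff r t (\<lambda>x. f x - g x) x = fin_diff r t f x - fin_diff r t g x"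
  unfolding fin_diff_def by (simp add: sum_subtractf right_diff_distrib)

lemma abs_fin_diff_le_modulus:
  assumes f: "f \<in> C_T" and t: "0 < t" "t \<le> h"
  shows "\<bar>fin_diff r t f x\<bar> \<le> modulus_smoothness r f h"
proof -
  obtain B where f_le: "\<forall>x. \<bar>f x\<bar> \<le> B" using bounded_C_T[OF f] by blast
  have B: "\<bar>fin_diff r t f x\<bar> \<le> 2 ^ r * B" for t x
    using f_le by (intro abs_fin_diff_le) blast
  then have "\<bar>fin_diff r t f x\<bar> \<le> sup_norm (fin_diff r t f)"
    unfolding sup_norm_def by (intro cSUP_upper bdd_aboveI2[where M = "2 ^ r * B"]) auto
  also have "\<dots> \<le> modulus_smoothness r f h"
    unfolding modulus_smoothness_def
  proof (rule cSUP_upper)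
    have "sup_norm (fin_diff r t f) \<le> 2 ^ r * B" for t
      unfolding sup_norm_def using B by (intro cSUP_least) auto
    then show "bdd_above ((\<lambda>t. sup_norm (fin_diff r t f)) ` {0<..h})" by (intro bdd_aboveI2)
  qed (use t in auto)
  finally show ?thesis .
qed

lemma fin_diff_zero_step:
  assumes "r \<ge> 1"
  shows "fin_diff r 0 g x = 0"
proof -
  have "fin_diff r 0 g x = (\<Sum>j\<le>r. (- 1) ^ j * real (r choose j)) * g x"
    unfolding fin_diff_def sum_distrib_right atLeast0AtMost by simp
  then show ?thesis using choose_alternating_sum[of r, where ?'a = real] assms by simp
qed

lemma averaged_difference_le:
  assumes h: "h > 0" and k: "k \<ge> 1"
    and G: "\<And>t x. 0 < t \<Longrightarrow> t \<le> h \<Longrightarrow> \<bar>fin_diff (2 * k) t (trig_sum N a b) x\<bar> \<le> G"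
  shows "\<bar>trig_sum N (\<lambda>j. averaged_multiplier k h j * a j) (\<lambda>j. averaged_multiplier k h j * b j) x\<bar>
    \<le> gamma_star_even k * G"
proof -
  let ?\<phi> = "\<lambda>t j. 2 / h\<^sup>2 * (h - t) * difference_multiplier k t j"
  let ?F = "\<lambda>t. trig_sum N (\<lambda>j. ?\<phi> t j * a j) (\<lambda>j. ?\<phi> t j * b j) x"
  have \<gamma>: "gamma_star_even k \<ge> 0" unfolding gamma_star_even_def by simp
  have "G \<ge> 0" using G[of h 0] h by (meson abs_ge_zero less_eq_real_def order_trans)
  have F: "(?F has_integral trig_sum N (\<lambda>j. averaged_multiplier k h j * a j) (\<lambda>j. averaged_multiplier k h j * b j) x) {0..h}"
    unfolding averaged_multiplier_def
    by (rule has_integral_trig_sum, unfold difference_multiplier_def)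
      (intro integrable_continuous_real continuous_intros)
  have B: "((\<lambda>t. 2 / h\<^sup>2 * (h - t) * (gamma_star_even k * G)) has_integral 1 * (gamma_star_even k * G)) {0..h}"
    by (intro has_integral_mult_left averaged_one_has_integral h)
  have "norm (integral {0..h} ?F) \<le> integral {0..h} (\<lambda>t. 2 / h\<^sup>2 * (h - t) * (gamma_star_even k * G))"
  proof (rule integral_norm_bound_integral)
    fix t assume t: "t \<in> {0..h}"
    have "?F t = 2 / h\<^sup>2 * (h - t) *
        ((- 1) ^ k * gamma_star_even k * fin_diff (2 * k) t (trig_sum N a b) (x - real k * t))"
      unfolding trig_sum_difference_multiplier[symmetric] trig_sum_scale by (simp only: mult.assoc)
    moreover have "\<bar>(- 1) ^ k * gamma_star_even k * fin_diff (2 * k) t (trig_sum N a b) (x - real k * t)\<bar>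
        \<le> gamma_star_even k * G"
    proof (cases "t = 0")
      case True
      then show ?thesis using k \<gamma> \<open>G \<ge> 0\<close> by (simp add: fin_diff_zero_step)
    next
      case False
      then show ?thesis using t \<gamma> G[of t] by (simp add: abs_mult mult_left_mono)
    qed
    moreover have "0 \<le> 2 / h\<^sup>2 * (h - t)" using t by simp
    ultimately show "norm (?F t) \<le> 2 / h\<^sup>2 * (h - t) * (gamma_star_even k * G)"
      unfolding real_norm_def by (simp only: abs_mult[of "2 / h\<^sup>2 * (h - t)"] abs_of_nonneg mult_left_mono)
  qed (use F B in \<open>auto simp: has_integral_iff\<close>)
  then show ?thesis by (simp only: integral_unique[OF F] integral_unique[OF B] real_norm_def mult_1)
qed

section \<open>The estimate for trigonometric sums and its extension by density\<close>

text \<open>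
  With \<open>u j = S j (n / j)\<^sup>2\<close> the truncated geometric series \<open>\<psi>\<close> satisfies \<open>\<psi> (1 - u) = 1 - u ^ Suc M\<close> at the frequencies
  \<open>j \<ge> n\<close>.  Hence the sum differs from its image under \<open>\<psi>\<close> times the averaged differences by a polynomial of degree
  below \<open>n\<close> and by a remainder with coefficients of size \<open>y ^ (2 * Suc M)\<close>.
\<close>

lemma trig_sum_jackson:
  assumes n: "n \<ge> 1" and k: "k \<ge> 1" and \<alpha>: "\<alpha> > 1" and h: "h = \<alpha> / (2 * real n)"
    and G: "\<And>t x. 0 < t \<Longrightarrow> t \<le> h \<Longrightarrow> \<bar>fin_diff (2 * k) t (trig_sum N a b) x\<bar> \<le> G"
    and e: "e > 0"
  shows "\<exists>\<tau>\<in>trig_polys n. \<forall>x. \<bar>trig_sum N a b x - \<tau> x\<bar> \<le>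
    inverse (cos (pi / (2 * \<alpha>))) * (gamma_star_even k * G) + e"
proof -
  define y where "y = 1 / \<alpha>"
  have y: "0 < y" "y < 1" using \<alpha> by (auto simp: y_def)
  have hpos: "h > 0" using n \<alpha> h by simp
  define S where "S = averaging_defect k y h"
  define lam where "lam = averaged_multiplier k h"
  define u where "u j = S j * (real n / real j)\<^sup>2" for j
  define A where "A = (\<Sum>j<N. \<bar>a j\<bar> + \<bar>b j\<bar>)"
  have S: "multiplier_bound S (y\<^sup>2)" unfolding S_def by (rule averaging_defect_bound)
  have lam_high: "lam j = 1 - u j" if "j \<ge> n" for j
    unfolding lam_def u_def S_def y_def using averaged_multiplier_eq[OF n, of j \<alpha> h k] that n \<alpha> h by simp
  have u_le: "\<bar>u j\<bar> \<le> y\<^sup>2" if "j \<ge> n" for j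
  proof -
    have "(real n / real j)\<^sup>2 \<le> 1" using that n by (simp add: power_le_one)
    then have "\<bar>S j\<bar> * (real n / real j)\<^sup>2 \<le> y\<^sup>2 * 1"
      using multiplier_bound_imp_abs_le[OF S, of j] by (intro mult_mono) auto
    then show ?thesis unfolding u_def by (simp add: abs_mult)
  qed
  have "(\<lambda>M. (y\<^sup>2) ^ M * A) \<longlonglongrightarrow> 0 * A"
    using y by (intro tendsto_mult_right LIMSEQ_realpow_zero) (auto simp: power_less_one_iff)
  then have "\<forall>\<^sub>F M in sequentially. (y\<^sup>2) ^ M * A < e" using e by (intro order_tendstoD(2)) auto
  then obtain M0 where M0: "\<And>M. M \<ge> M0 \<Longrightarrow> (y\<^sup>2) ^ M * A < e" unfolding eventually_sequentially by blast
  define M where "M = M0"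
  have M: "(y\<^sup>2) ^ Suc M * A < e" using M0[of "Suc M"] by (simp add: M_def)
  define \<psi> where "\<psi> j = 1 + (\<Sum>i<M. S j ^ Suc i * inverse_power_multiplier n (2 * i + 1) j)" for j
  have \<psi>: "multiplier_bound \<psi> (1 / cos (pi * y / 2))"
  proof -
    have bound: "multiplier_bound \<psi> (\<bar>1\<bar> + (\<Sum>i<M. (y\<^sup>2) ^ Suc i * arctan_moment (2 * i + 1)))"
      unfolding \<psi>_def [abs_def]
      by (intro multiplier_bound_add multiplier_bound_const multiplier_bound_sum multiplier_bound_mult
          multiplier_bound_power S inverse_power_multiplier_bound n) simp
    have pow: "(y\<^sup>2) ^ Suc i = y ^ (2 * i + 2)" for i
      unfolding power_mult[symmetric] by simp
    have "\<bar>1\<bar> + (\<Sum>i<M. (y\<^sup>2) ^ Suc i * arctan_moment (2 * i + 1)) \<le> 1 / cos (pi * y / 2)"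
      unfolding pow abs_one using y by (intro sum_arctan_moments_le) auto
    with bound show ?thesis by (rule multiplier_bound_mono)
  qed
  have residual: "1 - \<psi> j * lam j = u j ^ Suc M" if "j \<ge> n" for j
  proof -
    have "S j ^ Suc i * inverse_power_multiplier n (2 * i + 1) j = u j ^ Suc i" for i
    proof -
      have "(real n / real j) ^ Suc (2 * i + 1) = ((real n / real j)\<^sup>2) ^ Suc i"
        unfolding power_mult[symmetric] by simp
      then show ?thesis
        unfolding u_def power_mult_distrib inverse_power_multiplier_high[OF n that] by simp
    qed
    then have "\<psi> j = (\<Sum>i<Suc M. u j ^ i)"
      unfolding \<psi>_def by (simp only: sum.lessThan_Suc_shift) simp
    then have "(1 - u j) * \<psi> j = 1 - u j ^ Suc M" by (simp only: one_diff_power_eq)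
    then show ?thesis unfolding lam_high[OF that] by (simp add: mult.commute)
  qed
  define r where "r j = 1 - \<psi> j * lam j" for j
  define lo where "lo c j = (if j < n then r j * c j else 0)" for c :: "nat \<Rightarrow> real" and j
  define hi where "hi c j = (if j < n then 0 else r j * c j)" for c :: "nat \<Rightarrow> real" and j
  show ?thesis
  proof (intro bexI allI)
    show "trig_sum N (lo a) (lo b) \<in> trig_polys n"
      by (rule trig_sum_in_trig_polys) (simp add: lo_def)
    fix x
    have W: "\<bar>trig_sum N (\<lambda>j. \<psi> j * (lam j * a j)) (\<lambda>j. \<psi> j * (lam j * b j)) x\<bar> \<le>
        1 / cos (pi * y / 2) * (gamma_star_even k * G)"
      unfolding lam_def by (intro multiplier_boundD[OF \<psi>] averaged_difference_le[OF hpos k] G)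
    have "\<bar>trig_sum N (hi a) (hi b) x\<bar> \<le> (\<Sum>j<N. \<bar>hi a j\<bar> + \<bar>hi b j\<bar>)" by (rule abs_trig_sum_le)
    also have "\<dots> \<le> (\<Sum>j<N. (y\<^sup>2) ^ Suc M * (\<bar>a j\<bar> + \<bar>b j\<bar>))"
    proof (rule sum_mono)
      fix j
      have "\<bar>hi c j\<bar> \<le> (y\<^sup>2) ^ Suc M * \<bar>c j\<bar>" for c
      proof (cases "j < n")
        case False
        then have "\<bar>r j\<bar> \<le> (y\<^sup>2) ^ Suc M"
          unfolding r_def using residual[of j] u_le[of j]
          by (simp only: power_abs power_mono abs_ge_zero not_less)
        then show ?thesis using False by (simp add: hi_def abs_mult mult_right_mono del: power_Suc)
      qed (simp add: hi_def)
      from this[of a] this[of b] show "\<bar>hi a j\<bar> + \<bar>hi b j\<bar> \<le> (y\<^sup>2) ^ Suc M * (\<bar>a j\<bar> + \<bar>b j\<bar>)"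
        by (simp add: distrib_left del: power_Suc)
    qed
    also have "\<dots> < e" unfolding sum_distrib_left[symmetric] A_def[symmetric] by (rule M)
    finally have H: "\<bar>trig_sum N (hi a) (hi b) x\<bar> < e" .
    have "trig_sum N a b x = trig_sum N (\<lambda>j. \<psi> j * (lam j * a j)) (\<lambda>j. \<psi> j * (lam j * b j)) x +
        trig_sum N (lo a) (lo b) x + trig_sum N (hi a) (hi b) x"
    proof -
      have "\<psi> j * (lam j * c j) + lo c j + hi c j = c j" for c j
        unfolding lo_def hi_def r_def by (simp add: algebra_simps)
      then show ?thesis unfolding trig_sum_add by simp
    qed
    then show "\<bar>trig_sum N a b x - trig_sum N (lo a) (lo b) x\<bar> \<le>
        inverse (cos (pi / (2 * \<alpha>))) * (gamma_star_even k * G) + e"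
      using W H unfolding y_def by (simp add: inverse_eq_divide mult.commute)
  qed
qed

theorem theorem5:
  fixes n k :: nat and f :: "real \<Rightarrow> real" and \<alpha> :: real
  assumes "n \<ge> 1" and "k \<ge> 1" and "f \<in> C_T" and "\<alpha> > 1"
  shows "best_approx n f \<le>
    inverse (cos (pi / (2 * \<alpha>))) * gamma_star_even k *
    modulus_smoothness (2 * k) f (\<alpha> / (2 * real n))"
proof (rule field_le_epsilon)
  fix \<epsilon> :: real assume "\<epsilon> > 0"
  let ?s = "inverse (cos (pi / (2 * \<alpha>)))" and ?\<gamma> = "gamma_star_even k"
    and ?\<omega> = "modulus_smoothness (2 * k) f (\<alpha> / (2 * real n))"
  have "pi / (2 * \<alpha>) < pi / 2" "- (pi / 2) < pi / (2 * \<alpha>)"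
    using assms(4) pi_gt_zero by (auto simp: field_simps intro: less_trans[of _ 0])
  then have "?s \<ge> 0" using cos_gt_zero_pi[of "pi / (2 * \<alpha>)"] by simp
  moreover have "?\<gamma> \<ge> 0" unfolding gamma_star_even_def by simp
  ultimately have C: "2 + ?s * ?\<gamma> * 2 ^ (2 * k) > 0" by (simp add: add_pos_nonneg)
  define e where "e = \<epsilon> / (2 + ?s * ?\<gamma> * 2 ^ (2 * k))"
  have e: "e > 0" "(2 + ?s * ?\<gamma> * 2 ^ (2 * k)) * e = \<epsilon>" using C \<open>\<epsilon> > 0\<close> by (auto simp: e_def)
  obtain N a b where P: "\<And>x. \<bar>f x - trig_sum N a b x\<bar> \<le> e"
    using trig_functions_dense[OF assms(3) e(1)] by blast
  have "\<bar>fin_diff (2 * k) t (trig_sum N a b) x\<bar> \<le> ?\<omega> + 2 ^ (2 * k) * e"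
    if "0 < t" "t \<le> \<alpha> / (2 * real n)" for t x
    using abs_fin_diff_le_modulus[OF assms(3) that, of "2 * k" x]
      abs_fin_diff_le[where g = "\<lambda>x. f x - trig_sum N a b x", OF P, where r = "2 * k" and t = t and x = x] unfolding fin_diff_diff by linarith
  from trig_sum_jackson[OF assms(1,2,4) refl this e(1)]
  obtain \<tau> where \<tau>: "\<tau> \<in> trig_polys n"
    "\<And>x. \<bar>trig_sum N a b x - \<tau> x\<bar> \<le> ?s * (?\<gamma> * (?\<omega> + 2 ^ (2 * k) * e)) + e" by blast
  have "\<bar>f x - \<tau> x\<bar> \<le> ?s * (?\<gamma> * (?\<omega> + 2 ^ (2 * k) * e)) + e + e" for x
    using P[of x] \<tau>(2)[of x] by linarith
  then have "best_approx n f \<le> ?s * (?\<gamma> * (?\<omega> + 2 ^ (2 * k) * e)) + e + e"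
    by (rule best_approx_le[OF assms(3) \<tau>(1)])
  also have "\<dots> = ?s * ?\<gamma> * ?\<omega> + (2 + ?s * ?\<gamma> * 2 ^ (2 * k)) * e" by (simp add: algebra_simps)
  finally show "best_approx n f \<le> ?s * ?\<gamma> * ?\<omega> + \<epsilon>" unfolding e(2) .
qed

end
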